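(* Let $\Omega=[0,1)$ with Lebesgue measure $\mathbb P$ and let $p(\cdot):[0,1)\to(0,\infty)$ be measurable with $p_-=\operatorname{ess\,inf}p$, $p_+=\operatorname{ess\,sup}p$, $0<p_-\le p_+<\infty$. Assume that there is a constant $K\ge 1$ such that $\mathbb P(A)^{p_-(A)-p_+(A)}\le K$ for every dyadic interval $A\subset[0,1)$, that $\frac1{p_-}-\frac1{p_+}<1$, and that $1/2<p_-<\infty$. Let $f\in H_{p(\cdot)}$. If there exists a dyadic interval $I$ such that the restriction $f\chi_I\in L_1(I)$, then $$\lim_{n\to\infty}\sigma_nf(x)=f(x)\qquad\text{for a.e. } x\in I.$$
   Context: For measurable $A\subset[0,1)$, $p_-(A)=\operatorname{ess\,inf}_{x\in A}p(x)$ and $p_+(A)=\operatorname{ess\,sup}_{x\in A}p(x)$. $\|f\|_{p(\cdot)}=\inf\{\lambda>0:\int_0^1(|f(x)|/\lambda)^{p(x)}dx\le1\}$. Dyadic intervals are $[k2^{-n},(k+1)2^{-n})$, $n\in\mathbb N=\{0,1,2,\dots\}$, $0\le k<2^n$; $\mathcal F_n$ is the $\sigma$-algebra generated by the dyadic intervals of length $2^{-n}$. Martingales $f=(f_n)_{n\ge0}$ are taken with respect to $(\mathcal F_n)$. $M(f)=\sup_{n\ge0}|f_n|$. $H_{p(\cdot)}$ is the space of martingales with $\|f\|_{H_{p(\cdot)}}=\|M(f)\|_{p(\cdot)}<\infty$ (the paper uses this notation for any of five martingale Hardy spaces, which coincide with equivalent quasi-norms in the dyadic setting; this is one of them). For a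 dyadic interval $I$ of length $2^{-k}$, the restriction of the martingale $f$ to $I$ is the sequence $f\chi_I=(f_n\chi_I)_{n\ge k}$. The condition $f\chi_I\in L_1(I)$ means that this martingale is generated by an integrable function on $I$, again denoted $f$: there is $f\in L_1(I)$ with $f_n\chi_I=\mathbb E(f\chi_I|\mathcal F_n)$ for all $n\ge k$; this function is the $f(x)$ in the conclusion. Walsh system: $r(x)=1$ on $[0,1/2)$, $r(x)=-1$ on $[1/2,1)$, extended with period 1; $r_n(x)=r(2^nx)$; for $n=\sum_{k\ge0}n_k2^k$ with $n_k\in\{0,1\}$, $w_n=\prod_{k\ge0}r_k^{n_k}$. For a martingale $f$, $\widehat f(n)=\lim_{k\to\infty}\mathbb E(f_kw_n)$ (the sequence is eventually constant). Partial sums: $s_nf=\sum_{k=0}^{n-1}\widehat f(k)w_k$. Fejér means: $\sigma_nf=\frac1n\sum_{k=1}^ns_kf$, $n\ge1$. *)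

theory Defs
  imports "HOL-Probability.Essential_Supremum" "HOL-Probability.Conditional_Expectation"
begin

definition Omega :: "real measure" where
  "Omega = lebesgue_on {0..<1}"

definition dyadic_interval :: "nat \<Rightarrow> nat \<Rightarrow> real set" where
  "dyadic_interval n k = {real k / 2 ^ n ..< (real k + 1) / 2 ^ n}"

(* Only the sets of this measure matter: conditional expectations take the measure from Omega. *)
definition dyadic_filtration :: "nat \<Rightarrow> real measure" where
  "dyadic_filtration n = sigma {0..<1} {dyadic_interval n k | k. k < 2 ^ n}"

definition p_minus :: "(real \<Rightarrow> real) \<Rightarrow> real set \<Rightarrow> ereal" where
  "p_minus p A = Sup {c. AE x in restrict_space Omega A. c \<le> ereal (p x)}"

definition p_plus :: "(real \<Rightarrow> real) \<Rightarrow> real set \<Rightarrow> ereal" where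
  "p_plus p A = esssup (restrict_space Omega A) (\<lambda>x. ereal (p x))"

definition ennreal_powr :: "ennreal \<Rightarrow> real \<Rightarrow> ennreal" where
  "ennreal_powr a t = (if a = \<infinity> then \<infinity> else ennreal (enn2real a powr t))"

(* The argument u plays the role of |f|, so that u may be a maximal function,
   which can be infinite at some points. The infimum of the empty set is infinity. *)
definition var_norm :: "(real \<Rightarrow> real) \<Rightarrow> (real \<Rightarrow> ennreal) \<Rightarrow> ennreal" where
  "var_norm p u =
     Inf {ennreal l | l::real. l > 0 \<and> (\<integral>\<^sup>+ x. ennreal_powr (u x / ennreal l) (p x) \<partial>Omega) \<le> 1}"

definition dyadic_martingale :: "(nat \<Rightarrow> real \<Rightarrow> real) \<Rightarrow> bool" where
  "dyadic_martingale f \<longleftrightarrow>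
     (\<forall>n. f n \<in> borel_measurable (dyadic_filtration n) \<and> integrable Omega (f n)) \<and>
     (\<forall>m n. m \<le> n \<longrightarrow> (AE x in Omega. real_cond_exp Omega (dyadic_filtration m) (f n) x = f m x))"

definition maximal_function :: "(nat \<Rightarrow> real \<Rightarrow> real) \<Rightarrow> real \<Rightarrow> ennreal" where
  "maximal_function f x = (SUP n. ennreal \<bar>f n x\<bar>)"

definition hardy_space :: "(real \<Rightarrow> real) \<Rightarrow> (nat \<Rightarrow> real \<Rightarrow> real) set" where
  "hardy_space p = {f. dyadic_martingale f \<and> var_norm p (maximal_function f) < \<infinity>}"

(* f chi_I is the martingale generated by the function g in L_1(I), where I has length 2^(-k). *)
definition restriction_generated_by ::
    "(nat \<Rightarrow> real \<Rightarrow> real) \<Rightarrow> nat \<Rightarrow> real set \<Rightarrow> (real \<Rightarrow> real) \<Rightarrow> bool" where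
  "restriction_generated_by f k I g \<longleftrightarrow>
     set_integrable Omega I g \<and>
     (\<forall>n\<ge>k. AE x in Omega. f n x * indicator I x =
        real_cond_exp Omega (dyadic_filtration n) (\<lambda>y. g y * indicator I y) x)"

definition rademacher :: "nat \<Rightarrow> real \<Rightarrow> real" where
  "rademacher n x = (if frac (2 ^ n * x) < 1 / 2 then 1 else - 1)"

(* The binary digit n_k is 1 iff bit n k; all factors with n_k = 0 equal 1. *)
definition walsh :: "nat \<Rightarrow> real \<Rightarrow> real" where
  "walsh n x = (\<Prod>k\<in>{k. bit n k}. rademacher k x)"

definition walsh_coeff :: "(nat \<Rightarrow> real \<Rightarrow> real) \<Rightarrow> nat \<Rightarrow> real" where
  "walsh_coeff f n = lim (\<lambda>k. \<integral>x. f k x * walsh n x \<partial>Omega)"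

definition walsh_partial_sum :: "(nat \<Rightarrow> real \<Rightarrow> real) \<Rightarrow> nat \<Rightarrow> real \<Rightarrow> real" where
  "walsh_partial_sum f n x = (\<Sum>k<n. walsh_coeff f k * walsh k x)"

definition fejer_mean :: "(nat \<Rightarrow> real \<Rightarrow> real) \<Rightarrow> nat \<Rightarrow> real \<Rightarrow> real" where
  "fejer_mean f n x = (1 / real n) * (\<Sum>k=1..n. walsh_partial_sum f k x)"

end

theory Submission
  imports Defs
begin

text \<open>
  The variable exponent enters only through one constant exponent. As \<open>p_minus p {0..<1} > 1 / 2\<close> and
  the measure is finite, the maximal function of \<open>f\<close> lies in \<open>L\<^sub>q\<close> for some \<open>1 / 2 < q < 1\<close>
  (lemma \<open>hardy_space_majorant\<close>). Everything else is a direct estimate of the Fejer means at a point.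

  Write \<open>E\<^sub>m F\<close> for the average of \<open>F\<close> over dyadic intervals of length \<open>2 ^ (- m)\<close> (\<open>avg\<close>) and
  \<open>flip j x\<close> for the point \<open>x\<close> with one binary digit inverted. Splitting a Walsh sum at the highest
  binary digit of its length gives, for \<open>n < 2 ^ (N + 1)\<close>, the pointwise majorant
  \<open>n \<bar>\<sigma>\<^sub>n F(x)\<bar> \<le> 2 \<Sum>m\<le>N. \<Sum>j\<le>m. 2 ^ j E\<^sub>m \<bar>F\<bar> (flip j x)\<close> (lemma \<open>fejer_sum_le\<close>).
  It is applied with \<open>2 ^ N \<le> n\<close> to \<open>F = f (N + 1) - g x\<close>, where \<open>x\<close> is a point of the given
  interval \<open>I\<close> of length \<open>2 ^ (- i)\<close>. Two kinds of terms arise.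

  For \<open>j \<ge> i\<close> the flipped points stay in \<open>I\<close>, and the averages are at most those of
  \<open>\<bar>g - g x\<bar>\<close>. The terms tend to 0 at almost every \<open>x\<close>, since almost every point is a Lebesgue
  point for the averages around all flipped points (lemma \<open>AE_flip_sum_tendsto\<close>). This follows by
  density from a weak type inequality for the maximal operator of
  \<open>\<Sum>j\<le>m. 2 ^ (j - m) E\<^sub>m \<bar>F\<bar> (flip j x)\<close> (lemma \<open>flip_sum_weak_type\<close>).

  For the finitely many \<open>j < i\<close>, let \<open>v\<close> be the \<open>q\<close>-th power of the maximal function. Since
  \<open>f L\<close> is constant on dyadic intervals of length \<open>2 ^ (- L)\<close>, its averages are at most
  \<open>R powr (1 / q) * (2 powr (1 / q - 1)) ^ L\<close> wherever all averages of \<open>v\<close> are at most \<open>R\<close>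
  (lemma \<open>avg_abs_le_powr\<close>), and such an \<open>R\<close> exists almost everywhere. Flips preserve null sets, so
  this may be used at \<open>flip j x\<close>. As \<open>q > 1 / 2\<close>, the base is less than 2, and division by \<open>n\<close> makes
  the terms tend to 0.
\<close>

section \<open>Dyadic intervals, digit flips and Walsh functions\<close>

text \<open>
  The dyadic interval of length \<open>2 ^ (- m)\<close> that contains \<open>x\<close>. It is written as an equivalence
  class, so that it makes sense for every real \<open>x\<close> and no index has to be carried along.
\<close>

definition cell :: "nat \<Rightarrow> real \<Rightarrow> real set" where
  "cell m x = {t. \<lfloor>2 ^ m * t\<rfloor> = \<lfloor>2 ^ m * x\<rfloor>}"

text \<open>
  The conditional expectation of \<open>F\<close> on the dyadic intervals of length \<open>2 ^ (- m)\<close>, as an everywhere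
  defined function.
\<close>

definition avg :: "nat \<Rightarrow> (real \<Rightarrow> real) \<Rightarrow> real \<Rightarrow> real" where
  "avg m F x = 2 ^ m * (\<integral>t. indicator (cell m x) t * F t \<partial>Omega)"

text \<open>
  Dyadic addition of \<open>2 ^ (- (j + 1))\<close>: the binary digit of \<open>x\<close> with weight \<open>2 ^ (- (j + 1))\<close> is
  inverted.
\<close>

definition flip :: "nat \<Rightarrow> real \<Rightarrow> real" where
  "flip j x = x + rademacher j x / 2 ^ Suc j"

text \<open>
  Walsh--Fourier partial sums of an integrable function.
\<close>

definition walsh_sum :: "(real \<Rightarrow> real) \<Rightarrow> nat \<Rightarrow> real \<Rightarrow> real" where
  "walsh_sum F n x = (\<Sum>k<n. (\<integral>t. F t * walsh k t \<partial>Omega) * walsh k x)"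

text \<open>
  The Fejer means times \<open>n\<close>; without the factor \<open>1 / n\<close> they obey simple recursions.
\<close>

definition fejer_sum :: "(real \<Rightarrow> real) \<Rightarrow> nat \<Rightarrow> real \<Rightarrow> real" where
  "fejer_sum F n x = (\<Sum>k=1..n. walsh_sum F k x)"

lemma space_Omega [simp]: "space Omega = {0..<1}"
  by (simp add: Omega_def)

lemma prob_space_Omega: "prob_space Omega"
  by (rule prob_spaceI) (simp add: Omega_def emeasure_restrict_space)

interpretation Omega: prob_space Omega
  by (rule prob_space_Omega)

lemma borel_measurable_Omega [measurable_dest]:
  "(F :: real \<Rightarrow> 'a::topological_space) \<in> borel_measurable borel \<Longrightarrow> F \<in> borel_measurable Omega"
  unfolding Omega_def by (intro measurable_restrict_space1 measurable_completion) simp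

lemma floor_measurable_Omega [measurable]:
  "(\<lambda>x. \<lfloor>2 ^ m * x\<rfloor>) \<in> measurable Omega (count_space UNIV)"
proof -
  have "(\<lambda>x::real. \<lfloor>2 ^ m * x\<rfloor>) \<in> measurable lebesgue (count_space UNIV)"
    by (rule measurable_completion) simp
  then show ?thesis
    unfolding Omega_def by (rule measurable_restrict_space1)
qed

lemma rademacher_eq: "rademacher m x = (if even \<lfloor>2 ^ Suc m * x\<rfloor> then 1 else - 1)"
proof -
  define a where "a = \<lfloor>2 ^ m * x\<rfloor>"
  have fr: "2 ^ m * x = a + frac (2 ^ m * x)"
    unfolding a_def by (simp add: frac_def)
  show ?thesis
  proof (cases "frac (2 ^ m * x) < 1/2")
    case True
    have "\<lfloor>2 ^ Suc m * x\<rfloor> = 2 * a"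
    proof -
      have "2 ^ Suc m * x = 2 * a + 2 * frac (2^m * x)" using fr by simp
      then show ?thesis using True frac_ge_0[of "2 ^ m * x"] by (intro floor_unique) auto
    qed
    then show ?thesis using True by (simp add: rademacher_def)
  next
    case False
    have "\<lfloor>2 ^ Suc m * x\<rfloor> = 2 * a + 1"
    proof -
      have "2 ^ Suc m * x = 2 * a + 2 * frac (2^m * x)" using fr by simp
      then show ?thesis using False frac_lt_1[of "2 ^ m * x"] by (intro floor_unique) auto
    qed
    then show ?thesis using False by (simp add: rademacher_def)
  qed
qed

lemma floor_Suc:
  "\<lfloor>2 ^ Suc m * x\<rfloor> = 2 * \<lfloor>2 ^ m * x\<rfloor> + (if rademacher m x = 1 then 0 else 1)"
proof -
  have "\<lfloor>2 ^ m * x\<rfloor> = \<lfloor>2 ^ Suc m * x\<rfloor> div 2"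
    using floor_divide_real_eq_div[of 2 "2 ^ Suc m * x"] by simp
  then show ?thesis
    unfolding rademacher_eq by auto
qed

lemma mem_cell_Suc: "t \<in> cell (Suc m) x \<longleftrightarrow> t \<in> cell m x \<and> rademacher m t = rademacher m x"
proof -
  have r: "rademacher m y = 1 \<or> rademacher m y = - 1" for y
    by (simp add: rademacher_def)
  show ?thesis
    using r[of t] r[of x] unfolding cell_def mem_Collect_eq floor_Suc by (auto; presburger)
qed

lemma rademacher_cases: "rademacher m x = 1 \<or> rademacher m x = - 1"
  by (simp add: rademacher_def)

lemma abs_rademacher [simp]: "\<bar>rademacher m x\<bar> = 1"
  by (simp add: rademacher_def)

lemma cell_refl [simp]: "x \<in> cell m x" by (simp add: cell_def)

lemma cell_antimono: "m \<le> n \<Longrightarrow> cell n x \<subseteq> cell m x"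
  by (induction n rule: dec_induct) (auto simp: mem_cell_Suc)

lemma cell_eq: "t \<in> cell m x \<Longrightarrow> cell m t = cell m x"
  by (auto simp: cell_def)

lemma cell_sym: "t \<in> cell m x \<longleftrightarrow> x \<in> cell m t"
  by (auto simp: cell_def)

lemma floor_flip:
  assumes "j < m"
  shows "\<lfloor>2 ^ m * flip j x\<rfloor> = \<lfloor>2 ^ m * x\<rfloor> + (if rademacher j x = 1 then 1 else - 1) * 2 ^ (m - Suc j)"
proof -
  have "(2::real) ^ m / 2 ^ Suc j = 2 ^ (m - Suc j)"
    using assms by (subst power_diff) auto
  then have "2 ^ m * flip j x
      = 2 ^ m * x + of_int ((if rademacher j x = 1 then 1 else - 1) * 2 ^ (m - Suc j))"
    using rademacher_cases[of j x] by (auto simp: flip_def algebra_simps)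
  then show ?thesis by linarith
qed

lemma rademacher_flip_self: "rademacher j (flip j x) = - rademacher j x"
  using rademacher_cases[of j x]
  unfolding rademacher_eq[of j "flip j x"] floor_flip[OF lessI] rademacher_eq[of j x]
  by auto

lemma rademacher_flip:
  assumes "j < m"
  shows "rademacher m (flip j x) = rademacher m x"
proof -
  have "even ((2::int) ^ (Suc m - Suc j))" using assms by simp
  then show ?thesis
    using floor_flip[of j "Suc m" x] assms by (auto simp: rademacher_eq[of m])
qed

lemma flip_mem_cell: "m \<le> j \<Longrightarrow> flip j x \<in> cell m x"
proof -
  have "flip j x \<in> cell j x"
  proof -
    have "2 * \<lfloor>2 ^ j * flip j x\<rfloor> = 2 * \<lfloor>2 ^ j * x\<rfloor>"
      using floor_flip[OF lessI, of j x] floor_Suc[of j x] floor_Suc[of j "flip j x"]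
        rademacher_flip_self[of j x] rademacher_cases[of j x] by auto
    then show ?thesis by (simp add: cell_def)
  qed
  then show "m \<le> j \<Longrightarrow> flip j x \<in> cell m x" using cell_antimono by blast
qed

lemma cell_0: "x \<in> {0..<1} \<Longrightarrow> cell 0 x = {0..<1}"
proof -
  assume "x \<in> {0..<1}"
  then have "\<lfloor>x\<rfloor> = 0" by (simp add: floor_eq_iff)
  then have "t \<in> cell 0 x \<longleftrightarrow> t \<in> {0..<1}" for t
    using floor_eq_iff[of t 0] by (simp add: cell_def)
  then show "cell 0 x = {0..<1}" by blast
qed

lemma cell_subset_unit: "x \<in> {0..<1} \<Longrightarrow> cell m x \<subseteq> {0..<1}"
  using cell_antimono[of 0 m x] cell_0 by auto

lemma flip_mem_unit [simp]: "x \<in> {0..<1} \<Longrightarrow> flip j x \<in> {0..<1}"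
  using flip_mem_cell[of 0 j x] cell_0 by auto

lemma flip_unit_bounds [simp]: "0 \<le> x \<Longrightarrow> x < 1 \<Longrightarrow> 0 \<le> flip j x" 
    "0 \<le> x \<Longrightarrow> x < 1 \<Longrightarrow> flip j x < 1"
  using flip_mem_unit[of x j] by auto

lemma bit_imp_le:
  assumes "bit (n::nat) k" shows "2 ^ k \<le> n"
proof (rule ccontr)
  assume "\<not> 2 ^ k \<le> n"
  then have "n div 2 ^ k = 0" by simp
  then show False using assms by (simp add: bit_iff_odd)
qed

lemma finite_bits [simp]: "finite {k. bit (n::nat) k}"
proof (rule finite_subset)
  have "k \<le> n" if "bit n k" for k
    using bit_imp_le[OF that] less_exp[of k] by linarith
  then show "{k. bit n k} \<subseteq> {..n}" by auto
qed simp

lemma walsh_0 [simp]: "walsh 0 x = 1"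
  by (simp add: walsh_def)

lemma walsh_add:
  assumes "l < 2 ^ m"
  shows "walsh (2 ^ m + l) x = rademacher m x * walsh l x"
proof -
  have l: "\<not> bit l m" using bit_imp_le[of l m] assms by auto
  have "{k. bit (2 ^ m + l) k} = insert m {k. bit l k}"
    using l by (subst bit_disjunctive_add_iff) (auto simp: bit_exp_iff)
  then show ?thesis using l by (simp add: walsh_def)
qed

lemma abs_walsh [simp]: "\<bar>walsh n x\<bar> = 1"
  unfolding walsh_def by (simp add: abs_prod)

lemma walsh_cell_cong:
  assumes n: "n < 2 ^ m" and t: "t \<in> cell m x"
  shows "walsh n t = walsh n x"
  unfolding walsh_def
proof (rule prod.cong)
  fix k assume "k \<in> {k. bit n k}"
  then have "bit n k" by simp
  then have "2 ^ k < (2::nat) ^ m" using n by (rule le_less_trans[OF bit_imp_le])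
  then have "k < m" using power_strict_increasing_iff[of "2::nat" k m] by simp
  then have "Suc k \<le> m" by (rule Suc_leI)
  then have "t \<in> cell (Suc k) x"
    using t cell_antimono[of "Suc k" m] cell_sym by blast
  then show "rademacher k t = rademacher k x"
    by (simp add: mem_cell_Suc)
qed (rule refl)

lemma rademacher_measurable [measurable]: "rademacher m \<in> borel_measurable borel"
proof -
  have "(\<lambda>x. rademacher m x) \<in> borel_measurable borel"
    unfolding rademacher_eq by measurable
  then show ?thesis by simp
qed

lemma walsh_measurable [measurable]: "walsh n \<in> borel_measurable borel"
proof -
  have "(\<lambda>x. walsh n x) \<in> borel_measurable borel"
    unfolding walsh_def by measurable
  then show ?thesis by simp
qed

lemma flip_measurable [measurable]: "flip j \<in> borel_measurable borel"
proof -
  have "(\<lambda>x. flip j x) \<in> borel_measurable borel"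
    unfolding flip_def by measurable
  then show ?thesis by simp
qed

lemma cell_sets [measurable]: "cell m x \<in> sets borel"
proof -
  have "{t \<in> space borel. \<lfloor>2 ^ m * (t::real)\<rfloor> = \<lfloor>2 ^ m * x\<rfloor>} \<in> sets borel" by measurable
  then show ?thesis by (simp add: cell_def)
qed

lemma integrable_mult_bounded_Omega:
  fixes u F :: "real \<Rightarrow> real"
  assumes "integrable Omega F" "u \<in> borel_measurable Omega" "\<And>x. \<bar>u x\<bar> \<le> 1"
  shows "integrable Omega (\<lambda>x. u x * F x)"
proof (rule Bochner_Integration.integrable_bound[OF assms(1)])
  show "(\<lambda>x. u x * F x) \<in> borel_measurable Omega"
    using assms(1,2) by measurable
  show "AE x in Omega. norm (u x * F x) \<le> norm (F x)"
    using assms(3) by (auto simp: abs_mult intro!: mult_left_le_one_le)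
qed

lemma integrable_mult_bounded:
  fixes u F :: "real \<Rightarrow> real"
  assumes "integrable Omega F" "u \<in> borel_measurable borel" "\<And>x. \<bar>u x\<bar> \<le> 1"
  shows "integrable Omega (\<lambda>x. u x * F x)"
  by (rule integrable_mult_bounded_Omega[OF assms(1) borel_measurable_Omega[OF assms(2)] assms(3)])

lemma integrable_indicator_cell:
  fixes F :: "real \<Rightarrow> real"
  shows "integrable Omega F \<Longrightarrow> integrable Omega (\<lambda>t. indicator (cell m x) t * F t)"
  by (rule integrable_mult_bounded) (auto simp: indicator_def)

lemma integrable_rademacher:
  "integrable Omega F \<Longrightarrow> integrable Omega (\<lambda>t. rademacher m t * F t)"
  by (rule integrable_mult_bounded) auto

section \<open>Dyadic averages\<close>

text \<open>
  The relation on which all identities for Walsh sums rest: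
  \<open>1 + r\<^sub>m(x) r\<^sub>m(t)\<close> is twice the indicator of \<open>cell (m + 1) x\<close> on \<open>cell m x\<close>.
\<close>

lemma avg_Suc:
  assumes F: "integrable Omega F"
  shows "avg (Suc m) F x = avg m F x + rademacher m x * avg m (\<lambda>t. rademacher m t * F t) x"
proof -
  have eq: "2 * (indicator (cell (Suc m) x) t * F t)
      = indicator (cell m x) t * F t + rademacher m x * (indicator (cell m x) t * (rademacher m t * F t))" for t
    using rademacher_cases[of m t] rademacher_cases[of m x]
    by (auto simp: indicator_def mem_cell_Suc)
  have "2 * (\<integral>t. indicator (cell (Suc m) x) t * F t \<partial>Omega)
      = (\<integral>t. 2 * (indicator (cell (Suc m) x) t * F t) \<partial>Omega)"
    by simp
  also have "\<dots> = (\<integral>t. indicator (cell m x) t * F t \<partial>Omega)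
      + rademacher m x * (\<integral>t. indicator (cell m x) t * (rademacher m t * F t) \<partial>Omega)"
    unfolding eq using F
    by (subst Bochner_Integration.integral_add) (auto intro!: integrable_indicator_cell integrable_rademacher)
  finally have "2 ^ m * (2 * (\<integral>t. indicator (cell (Suc m) x) t * F t \<partial>Omega))
    = 2 ^ m * ((\<integral>t. indicator (cell m x) t * F t \<partial>Omega)
      + rademacher m x * (\<integral>t. indicator (cell m x) t * (rademacher m t * F t) \<partial>Omega))"
    by simp
  then show ?thesis unfolding avg_def distrib_left power_Suc by (simp only: ac_simps)
qed

lemma avg_cell_cong: "t \<in> cell m x \<Longrightarrow> avg m F t = avg m F x"
  by (simp add: avg_def cell_eq)

lemma avg_flip: "m \<le> j \<Longrightarrow> avg m F (flip j x) = avg m F x"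
  by (rule avg_cell_cong) (rule flip_mem_cell)

lemma avg_eq_halves:
  assumes F: "integrable Omega F"
  shows "avg m F x = (avg (Suc m) F x + avg (Suc m) F (flip m x)) / 2"
  unfolding avg_Suc[OF F] by (simp add: avg_flip rademacher_flip_self)

lemma avg_nonneg: "(\<And>x. 0 \<le> F x) \<Longrightarrow> 0 \<le> avg m F x"
  by (simp add: avg_def)

lemma avg_mono:
  assumes "integrable Omega F" "integrable Omega G" "AE t in Omega. t \<in> cell m x \<longrightarrow> F t \<le> G t"
  shows "avg m F x \<le> avg m G x"
  unfolding avg_def using assms
  by (intro mult_left_mono integral_mono_AE integrable_indicator_cell) (auto simp: indicator_def)

lemma abs_avg_le: "integrable Omega F \<Longrightarrow> \<bar>avg m F x\<bar> \<le> avg m (\<lambda>t. \<bar>F t\<bar>) x"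
proof -
  assume "integrable Omega F"
  have "\<bar>\<integral>t. indicator (cell m x) t * F t \<partial>Omega\<bar> \<le> (\<integral>t. \<bar>indicator (cell m x) t * F t\<bar> \<partial>Omega)"
    by (rule integral_abs_bound)
  also have "\<dots> = (\<integral>t. indicator (cell m x) t * \<bar>F t\<bar> \<partial>Omega)"
    by (simp add: abs_mult)
  finally show ?thesis
    by (simp add: avg_def abs_mult)
qed

lemma avg_add: "integrable Omega F \<Longrightarrow> integrable Omega G \<Longrightarrow>
  avg m (\<lambda>t. F t + G t) x = avg m F x + avg m G x"
  unfolding avg_def
  by (simp add: distrib_left integrable_indicator_cell)

lemma avg_double: "integrable Omega F \<Longrightarrow> (\<And>x. 0 \<le> F x) \<Longrightarrow> avg (Suc m) F x \<le> 2 * avg m F x"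
  using avg_eq_halves[of F m x] avg_nonneg[of F "Suc m" "flip m x"] by simp

lemma avg_0: "x \<in> {0..<1} \<Longrightarrow> avg 0 F x = (\<integral>t. F t \<partial>Omega)"
proof -
  assume x: "x \<in> {0..<1}"
  have "(\<integral>t. indicator (cell 0 x) t * F t \<partial>Omega) = (\<integral>t. F t \<partial>Omega)"
    unfolding cell_0[OF x] by (rule Bochner_Integration.integral_cong) auto
  then show ?thesis by (simp add: avg_def)
qed

lemma cell_eq_interval:
  "cell m x = {of_int \<lfloor>2 ^ m * x\<rfloor> / 2 ^ m ..< (of_int \<lfloor>2 ^ m * x\<rfloor> + 1) / 2 ^ m}"
  by (auto simp: cell_def floor_eq_iff field_simps)

lemma emeasure_Omega: "A \<in> sets borel \<Longrightarrow> A \<subseteq> {0..<1} \<Longrightarrow> emeasure Omega A = emeasure lborel A"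
  unfolding Omega_def by (subst emeasure_restrict_space) auto

lemma measure_cell:
  assumes x: "x \<in> {0..<1}"
  shows "measure Omega (cell m x) = 1 / 2 ^ m"
proof -
  have "emeasure Omega (cell m x) = emeasure lborel (cell m x)"
    using cell_subset_unit[OF x] by (intro emeasure_Omega) auto
  also have "\<dots> = ennreal (1 / 2 ^ m)"
    unfolding cell_eq_interval by (subst emeasure_lborel_Ico) (auto simp: field_simps)
  finally show ?thesis by (simp add: measure_def)
qed

lemma avg_const: 
  assumes x: "x \<in> {0..<1}"
  shows "avg m (\<lambda>_. c) x = c"
  using measure_cell[OF x, of m] cell_subset_unit[OF x, of m] by (simp add: avg_def Int_absorb2)

section \<open>Fejer sums and the pointwise majorant\<close>

lemma walsh_sum_add:
  assumes F: "integrable Omega F" and "k \<le> 2 ^ m"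
  shows "walsh_sum F (2 ^ m + k) x
    = walsh_sum F (2 ^ m) x + rademacher m x * walsh_sum (\<lambda>t. rademacher m t * F t) k x"
  using assms(2)
proof (induction k)
  case 0
  then show ?case by (simp add: walsh_sum_def)
next
  case (Suc k)
  then have k: "k < 2 ^ m" by simp
  have S: "walsh_sum G (Suc n) x = walsh_sum G n x + (\<integral>t. G t * walsh n t \<partial>Omega) * walsh n x" for G n
    by (simp add: walsh_sum_def)
  have "(\<integral>t. F t * walsh (2 ^ m + k) t \<partial>Omega) = (\<integral>t. rademacher m t * F t * walsh k t \<partial>Omega)"
    unfolding walsh_add[OF k] by (intro Bochner_Integration.integral_cong) auto
  then show ?case
    using Suc.IH k by (simp add: S walsh_add[OF k] distrib_left)
qed

lemma walsh_sum_power: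
  assumes F: "integrable Omega F" and x: "x \<in> {0..<1}"
  shows "walsh_sum F (2 ^ m) x = avg m F x"
  using F
proof (induction m arbitrary: F)
  case 0
  then show ?case by (simp add: walsh_sum_def avg_0[OF x])
next
  case (Suc m)
  have "walsh_sum F (2 ^ Suc m) x = walsh_sum F (2 ^ m + 2 ^ m) x" by (simp only: power_Suc mult_2)
  also have "\<dots> = avg (Suc m) F x"
    using Suc by (simp add: walsh_sum_add avg_Suc integrable_rademacher)
  finally show ?case .
qed

lemma fejer_sum_add:
  assumes F: "integrable Omega F" and k: "k \<le> 2 ^ m" and x: "x \<in> {0..<1}"
  shows "fejer_sum F (2 ^ m + k) x = fejer_sum F (2 ^ m) x + k * avg m F x
    + rademacher m x * fejer_sum (\<lambda>t. rademacher m t * F t) k x"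
  using k
proof (induction k)
  case 0
  then show ?case by (simp add: fejer_sum_def)
next
  case (Suc k)
  have S: "fejer_sum G (Suc n) x = fejer_sum G n x + walsh_sum G (Suc n) x" for G n
    by (simp add: fejer_sum_def)
  show ?case
    using Suc walsh_sum_add[OF F, of "Suc k" m x]
    by (simp add: S walsh_sum_power[OF F x] algebra_simps)
qed

text \<open>
  The kernel of index \<open>2 ^ m\<close> is carried by the cells of level \<open>m\<close> around \<open>x\<close> and around the
  points \<open>flip j x\<close>. The induction never mentions the kernel: it only combines the recursion for
  \<open>fejer_sum\<close> with \<open>avg_Suc\<close>.
\<close>

lemma fejer_sum_power:
  assumes F: "integrable Omega F" and x: "x \<in> {0..<1}"
  shows "2 * fejer_sum F (2 ^ m) x
    = (1 + 2 ^ m) * avg m F x + (\<Sum>j<m. 2 ^ j * avg m F (flip j x))"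
  using F
proof (induction m arbitrary: F)
  case 0
  then show ?case using walsh_sum_power[OF 0 x, of 0] by (simp add: fejer_sum_def)
next
  case (Suc m)
  let ?r = "rademacher m x" and ?G = "\<lambda>t. rademacher m t * F t"
  have G: "integrable Omega ?G" by (rule integrable_rademacher) fact
  have step: "avg (Suc m) F (flip j x) = avg m F (flip j x) + ?r * avg m ?G (flip j x)" if "j < m" for j
    using that by (simp add: avg_Suc[OF Suc.prems] rademacher_flip)
  have "2 * fejer_sum F (2 ^ Suc m) x = 2 * fejer_sum F (2 ^ m + 2 ^ m) x" by (simp only: power_Suc mult_2)
  also have "\<dots> = 2 * fejer_sum F (2 ^ m) x + 2 * 2 ^ m * avg m F x + ?r * (2 * fejer_sum ?G (2 ^ m) x)"
    by (subst fejer_sum_add[OF Suc.prems order_refl x]) (simp add: algebra_simps)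
  also have "\<dots> = (1 + 2 ^ m) * (avg m F x + ?r * avg m ?G x)
      + (\<Sum>j<m. 2 ^ j * (avg m F (flip j x) + ?r * avg m ?G (flip j x))) + 2 * 2 ^ m * avg m F x"
  proof -
    have "(\<Sum>j<m. 2 ^ j * (avg m F (flip j x) + ?r * avg m ?G (flip j x)))
      = (\<Sum>j<m. 2 ^ j * avg m F (flip j x)) + ?r * (\<Sum>j<m. 2 ^ j * avg m ?G (flip j x))"
      unfolding sum_distrib_left sum.distrib[symmetric]
      by (intro sum.cong refl) (simp only: algebra_simps)
    then show ?thesis
      unfolding Suc.IH[OF Suc.prems] Suc.IH[OF G] by (simp only: algebra_simps)
  qed
  also have "\<dots> = (1 + 2 ^ m) * avg (Suc m) F x
      + (\<Sum>j<m. 2 ^ j * avg (Suc m) F (flip j x))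
      + 2 ^ m * (avg (Suc m) F x + avg (Suc m) F (flip m x))"
    using avg_eq_halves[OF Suc.prems, of m x] by (simp add: step avg_Suc[OF Suc.prems, of m x])
  finally show ?case by (simp add: algebra_simps)
qed

text \<open>
  The positive operator that dominates the Fejer sums. For \<open>j = m\<close> the point \<open>flip j x\<close> lies in
  \<open>cell m x\<close>, so the last term is the average around \<open>x\<close> itself.
\<close>

definition flip_sum :: "nat \<Rightarrow> (real \<Rightarrow> real) \<Rightarrow> real \<Rightarrow> real" where
  "flip_sum m F x = (\<Sum>j\<le>m. 2 ^ j * avg m F (flip j x))"

lemma flip_sum_ge: "(\<And>x. 0 \<le> F x) \<Longrightarrow> 2 ^ m * avg m F x \<le> flip_sum m F x"
proof -
  assume F: "\<And>x. 0 \<le> F x"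
  have "2 ^ m * avg m F (flip m x) \<le> flip_sum m F x"
    unfolding flip_sum_def
    by (rule member_le_sum) (auto intro: mult_nonneg_nonneg avg_nonneg[OF F])
  then show ?thesis by (simp only: avg_flip[OF order_refl])
qed

lemma fejer_sum_power_le:
  assumes F: "integrable Omega F" and x: "x \<in> {0..<1}"
  shows "\<bar>fejer_sum F (2 ^ m) x\<bar> \<le> flip_sum m (\<lambda>t. \<bar>F t\<bar>) x"
proof -
  let ?A = "avg m (\<lambda>t. \<bar>F t\<bar>)"
  have pos: "0 \<le> ?A y" for y by (rule avg_nonneg) simp
  have "\<bar>2 * fejer_sum F (2 ^ m) x\<bar> \<le> (1 + 2 ^ m) * ?A x + (\<Sum>j<m. 2 ^ j * ?A (flip j x))"
    unfolding fejer_sum_power[OF assms]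
    using abs_avg_le[OF F, of m]
    by (intro order_trans[OF abs_triangle_ineq add_mono] order_trans[OF sum_abs sum_mono])
       (simp_all add: abs_mult mult_left_mono)
  also have "\<dots> \<le> (2 * 2 ^ m) * ?A x + 2 * (\<Sum>j<m. 2 ^ j * ?A (flip j x))"
    using pos[of x] sum_nonneg[of "{..<m}" "\<lambda>j. 2 ^ j * ?A (flip j x)"] pos
    by (intro add_mono mult_right_mono) simp_all
  also have "\<dots> = 2 * flip_sum m (\<lambda>t. \<bar>F t\<bar>) x"
    by (simp add: flip_sum_def lessThan_Suc_atMost[symmetric] avg_flip)
  finally show ?thesis by simp
qed

text \<open>
  The binary expansion of \<open>n\<close> is peeled off from the top: each step replaces \<open>F\<close> by a product with
  a Rademacher function, which does not change its absolute value.
\<close>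

lemma fejer_sum_le:
  assumes F: "integrable Omega F" and x: "x \<in> {0..<1}" and n: "n < 2 ^ N"
  shows "\<bar>fejer_sum F n x\<bar> \<le> 2 * (\<Sum>m<N. flip_sum m (\<lambda>t. \<bar>F t\<bar>) x)"
  using F n
proof (induction N arbitrary: F n)
  case 0
  then show ?case by (simp add: fejer_sum_def)
next
  case (Suc N)
  let ?B = "\<lambda>m. flip_sum m (\<lambda>t. \<bar>F t\<bar>) x"
  have pos: "0 \<le> ?B m" for m
    by (auto simp: flip_sum_def intro!: sum_nonneg mult_nonneg_nonneg avg_nonneg)
  show ?case
  proof (cases "n < 2 ^ N")
    case True
    then show ?thesis using Suc.IH[OF Suc.prems(1) True] pos[of N] by simp
  next
    case False
    define k where "k = n - 2 ^ N"
    have n: "n = 2 ^ N + k" and k: "k < 2 ^ N" using False Suc.prems by (auto simp: k_def)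
    let ?G = "\<lambda>t. rademacher N t * F t"
    have G: "integrable Omega ?G" by (rule integrable_rademacher) fact
    have "real k * \<bar>avg N F x\<bar> \<le> 2 ^ N * avg N (\<lambda>t. \<bar>F t\<bar>) x"
      using of_nat_mono[OF less_imp_le[OF k], where 'a = real] abs_avg_le[OF Suc.prems(1)]
      by (intro mult_mono) auto
    also have "\<dots> \<le> ?B N" by (rule flip_sum_ge) simp
    finally have 1: "\<bar>k * avg N F x\<bar> \<le> ?B N" by (simp add: abs_mult)
    have 2: "\<bar>rademacher N x * fejer_sum ?G k x\<bar> \<le> 2 * (\<Sum>m<N. ?B m)"
      using Suc.IH[OF G k] by (simp add: abs_mult)
    have tri: "\<lbrakk>\<bar>a\<bar> \<le> u; \<bar>b\<bar> \<le> u; \<bar>c\<bar> \<le> v\<rbrakk> \<Longrightarrow> \<bar>a + b + c\<bar> \<le> v + 2 * u" for a b c u v :: real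
      unfolding abs_le_iff by auto
    have "\<bar>fejer_sum F n x\<bar> \<le> 2 * (\<Sum>m<N. ?B m) + 2 * ?B N"
      unfolding n fejer_sum_add[OF Suc.prems(1) less_imp_le[OF k] x]
      by (rule tri[OF fejer_sum_power_le[OF Suc.prems(1) x] 1 2])
    then show ?thesis
      unfolding sum.lessThan_Suc distrib_left .
  qed
qed

section \<open>Measure preservation by flips and averages\<close>

lemma nn_integral_Omega:
  assumes [measurable]: "u \<in> borel_measurable borel"
  shows "(\<integral>\<^sup>+x. u x \<partial>Omega) = (\<integral>\<^sup>+x. u x * indicator {0..<1} x \<partial>lborel)"
  unfolding Omega_def
  by (subst nn_integral_restrict_space) (auto simp: nn_integral_completion)

lemma flip_flip [simp]: "flip j (flip j x) = x"
  unfolding flip_def[of j "flip j x"] rademacher_flip_self by (simp add: flip_def)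

lemma nn_integral_flip:
  assumes [measurable]: "u \<in> borel_measurable borel"
  shows "(\<integral>\<^sup>+x. u (flip j x) \<partial>Omega) = (\<integral>\<^sup>+x. u x \<partial>Omega)"
proof -
  \<comment> \<open>On each of the two values of the Rademacher function, the flip is a translation.\<close>
  define S where "S e = {x \<in> {0..<1}. rademacher j x = e}" for e :: real
  have S_sets [measurable]: "S e \<in> sets borel" for e
  proof -
    have "{x \<in> space borel. x \<in> {0..<1} \<and> rademacher j x = e} \<in> sets borel" by measurable
    then show ?thesis by (simp add: S_def)
  qed
  have half: "(\<integral>\<^sup>+x. u (flip j x) * indicator (S e) x \<partial>lborel) = (\<integral>\<^sup>+x. u x * indicator (S (- e)) x \<partial>lborel)" for e
  proof -
    have eq: "x \<in> S e \<longleftrightarrow> e / 2 ^ Suc j + 1 * x \<in> S (- e)" for x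
    proof
      assume x: "x \<in> S e"
      then have "flip j x \<in> S (- e)" by (auto simp: S_def rademacher_flip_self)
      then show "e / 2 ^ Suc j + 1 * x \<in> S (- e)"
        using x by (simp add: flip_def S_def add.commute)
    next
      assume x: "e / 2 ^ Suc j + 1 * x \<in> S (- e)"
      then have "flip j (e / 2 ^ Suc j + 1 * x) \<in> S e" by (auto simp: S_def rademacher_flip_self)
      then show "x \<in> S e" using x by (simp add: flip_def S_def)
    qed
    have "(\<integral>\<^sup>+x. u x * indicator (S (- e)) x \<partial>lborel)
        = (\<integral>\<^sup>+x. u (e / 2 ^ Suc j + 1 * x) * indicator (S (- e)) (e / 2 ^ Suc j + 1 * x) \<partial>lborel)"
      by (subst nn_integral_real_affine[of _ 1 "e / 2 ^ Suc j"]) auto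
    also have "\<dots> = (\<integral>\<^sup>+x. u (flip j x) * indicator (S e) x \<partial>lborel)"
    proof (rule nn_integral_cong)
      fix x
      show "u (e / 2 ^ Suc j + 1 * x) * indicator (S (- e)) (e / 2 ^ Suc j + 1 * x)
          = u (flip j x) * indicator (S e) x"
      proof (cases "x \<in> S e")
        case True
        then have "flip j x = e / 2 ^ Suc j + 1 * x" by (simp add: flip_def S_def)
        then show ?thesis using True eq[of x] by simp
      next
        case False
        then show ?thesis using eq[of x] by simp
      qed
    qed
    finally show ?thesis by simp
  qed
  have split: "(\<integral>\<^sup>+x. v x \<partial>Omega)
      = (\<integral>\<^sup>+x. v x * indicator (S 1) x \<partial>lborel) + (\<integral>\<^sup>+x. v x * indicator (S (- 1)) x \<partial>lborel)"
    if [measurable]: "v \<in> borel_measurable borel" for v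
  proof -
    have "indicator {0..<1} x = (indicator (S 1) x + indicator (S (- 1)) x :: ennreal)" for x
      using rademacher_cases[of j x] by (auto simp: S_def indicator_def)
    then show ?thesis
      by (simp add: nn_integral_Omega distrib_left nn_integral_add)
  qed
  show ?thesis
    by (simp add: split half add.commute)
qed

lemma AE_Omega_lborel: "(AE x in Omega. P x) \<longleftrightarrow> (AE x in lborel. x \<in> {0..<1} \<longrightarrow> P x)"
  unfolding Omega_def by (subst AE_restrict_space_iff) (auto simp: AE_completion_iff)

lemma AE_flip:
  assumes "AE x in Omega. P x"
  shows "AE x in Omega. P (flip j x)"
proof -
  have "AE x in lborel. x \<in> {0..<1} \<longrightarrow> P x"
    using assms by (simp only: AE_Omega_lborel)
  then obtain N where N: "N \<in> null_sets lborel" "{x. \<not> (x \<in> {0..<1} \<longrightarrow> P x)} \<subseteq> N"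
    unfolding eventually_ae_filter space_lborel by auto
  then have [measurable]: "N \<in> sets borel" by auto
  have "(\<integral>\<^sup>+x. indicator N (flip j x) \<partial>Omega) = (\<integral>\<^sup>+x. indicator N x \<partial>Omega)"
    by (rule nn_integral_flip) simp
  also have "\<dots> \<le> (\<integral>\<^sup>+x. indicator N x \<partial>lborel)"
  proof -
    have "(\<integral>\<^sup>+x. indicator N x * indicator {0..<1} x \<partial>lborel) \<le> (\<integral>\<^sup>+x. indicator N x \<partial>lborel)"
      by (intro nn_integral_mono) (simp add: indicator_def)
    then show ?thesis by (subst nn_integral_Omega) simp_all
  qed
  also have "\<dots> = 0" using N by auto
  finally have "AE x in Omega. indicator N (flip j x) = (0::ennreal)"
    by (subst nn_integral_0_iff_AE[symmetric])
       (auto intro!: borel_measurable_Omega)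
  moreover have "AE x in Omega. x \<in> {0..<1}" by (rule AE_I2) simp
  ultimately show ?thesis
  proof eventually_elim
    case (elim x)
    then have "flip j x \<notin> N" "flip j x \<in> {0..<1}" by (auto simp: indicator_def split: if_splits)
    then show ?case using N by auto
  qed
qed

lemma avg_measurable [measurable]: "avg m F \<in> borel_measurable borel"
proof -
  define h where "h z = 2 ^ m * (\<integral>t. indicator {t. \<lfloor>2 ^ m * t\<rfloor> = z} t * F t \<partial>Omega)" for z
  have "avg m F = (\<lambda>x. h \<lfloor>2 ^ m * x\<rfloor>)"
    by (auto simp: avg_def h_def cell_def fun_eq_iff)
  moreover have "(\<lambda>x::real. h \<lfloor>2 ^ m * x\<rfloor>) \<in> borel_measurable borel"
    by (rule measurable_compose[of _ _ "count_space UNIV"]) simp_all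
  ultimately show ?thesis by simp
qed

lemma ennreal_avg:
  assumes F: "integrable Omega F" "\<And>x. 0 \<le> F x"
  shows "ennreal (avg m F x) = (\<integral>\<^sup>+t. ennreal (2 ^ m) * (indicator (cell m x) t * ennreal (F t)) \<partial>Omega)"
proof -
  have "(\<integral>\<^sup>+t. ennreal (2 ^ m) * (indicator (cell m x) t * ennreal (F t)) \<partial>Omega)
      = (\<integral>\<^sup>+t. ennreal (2 ^ m * (indicator (cell m x) t * F t)) \<partial>Omega)"
    using F(2) by (intro nn_integral_cong) (auto simp: indicator_def ennreal_mult)
  also have "\<dots> = ennreal (\<integral>t. 2 ^ m * (indicator (cell m x) t * F t) \<partial>Omega)"
    using F by (intro nn_integral_eq_integral Bochner_Integration.integrable_mult_right integrable_indicator_cell) auto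
  finally show ?thesis by (simp add: avg_def)
qed

text \<open>
  Averaging does not change integrals over sets that are unions of cells; by Fubini, since the kernel
  of the averaging operator is symmetric.
\<close>

lemma nn_integral_avg:
  assumes F: "integrable Omega F" "\<And>x. 0 \<le> F x"
    and A [measurable]: "A \<in> sets borel" and inv: "\<And>x t. t \<in> cell m x \<Longrightarrow> t \<in> A \<longleftrightarrow> x \<in> A"
  shows "(\<integral>\<^sup>+x. indicator A x * ennreal (avg m F x) \<partial>Omega)
    = (\<integral>\<^sup>+x. indicator A x * ennreal (F x) \<partial>Omega)"
proof -
  interpret pair_sigma_finite Omega Omega
    by (intro pair_sigma_finite.intro Omega.sigma_finite_measure_axioms)
  have [measurable]: "F \<in> borel_measurable Omega" using F by auto
  have [measurable]: "A \<inter> {0..<1} \<in> sets Omega"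
    unfolding Omega_def by (auto simp: sets_restrict_space_iff)
  define k where "k p = (indicator {q. \<lfloor>2 ^ m * fst q\<rfloor> = \<lfloor>2 ^ m * snd q\<rfloor>} p :: ennreal)" for p :: "real \<times> real"
  have k: "k (x, t) = indicator (cell m x) t" "k (x, t) = indicator (cell m t) x" for x t
    by (auto simp: k_def cell_def indicator_def)
  have [measurable]: "k \<in> borel_measurable (Omega \<Otimes>\<^sub>M Omega)"
  proof -
    have "{q \<in> space (Omega \<Otimes>\<^sub>M Omega). \<lfloor>2 ^ m * fst q\<rfloor> = \<lfloor>2 ^ m * snd q\<rfloor>} \<in> sets (Omega \<Otimes>\<^sub>M Omega)"
      by measurable
    then have "(indicator {q \<in> space (Omega \<Otimes>\<^sub>M Omega). \<lfloor>2 ^ m * fst q\<rfloor> = \<lfloor>2 ^ m * snd q\<rfloor>} :: _ \<Rightarrow> ennreal)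
        \<in> borel_measurable (Omega \<Otimes>\<^sub>M Omega)"
      by (rule borel_measurable_indicator)
    then show ?thesis
      by (rule measurable_cong[THEN iffD1, rotated]) (auto simp: k_def indicator_def)
  qed
  have iA [measurable]: "(indicator A :: real \<Rightarrow> ennreal) \<in> borel_measurable Omega"
    by (rule borel_measurable_Omega) simp
  have "(\<integral>\<^sup>+x. indicator A x * ennreal (avg m F x) \<partial>Omega)
      = (\<integral>\<^sup>+x. (\<integral>\<^sup>+t. indicator A x * (ennreal (2 ^ m) * (k (x, t) * ennreal (F t))) \<partial>Omega) \<partial>Omega)"
    unfolding ennreal_avg[OF F] k(1)[symmetric]
    by (intro nn_integral_cong) (simp add: nn_integral_cmult)
  also have "\<dots> = (\<integral>\<^sup>+t. (\<integral>\<^sup>+x. indicator A x * (ennreal (2 ^ m) * (k (x, t) * ennreal (F t))) \<partial>Omega) \<partial>Omega)"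
    by (rule Fubini'[symmetric]) measurable
  also have "\<dots> = (\<integral>\<^sup>+t. indicator A t * ennreal (F t) \<partial>Omega)"
  proof (rule nn_integral_cong)
    fix t assume "t \<in> space Omega"
    then have t: "t \<in> {0..<1}" by simp
    have "(\<integral>\<^sup>+x. indicator A x * (ennreal (2 ^ m) * (k (x, t) * ennreal (F t))) \<partial>Omega)
        = (\<integral>\<^sup>+x. (indicator A t * ennreal (F t)) * (ennreal (2 ^ m) * indicator (cell m t) x) \<partial>Omega)"
    proof (rule nn_integral_cong)
      fix x
      show "indicator A x * (ennreal (2 ^ m) * (k (x, t) * ennreal (F t)))
          = (indicator A t * ennreal (F t)) * (ennreal (2 ^ m) * indicator (cell m t) x)"
      proof (cases "x \<in> cell m t")
        case True
        then have "(indicator A x :: ennreal) = indicator A t" using inv[OF True] by (simp add: indicator_def)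
        then show ?thesis by (simp add: k(2) ac_simps)
      next
        case False
        then show ?thesis by (simp add: k(2))
      qed
    qed
    also have "\<dots> = (indicator A t * ennreal (F t)) * (\<integral>\<^sup>+x. ennreal (2 ^ m) * indicator (cell m t) x \<partial>Omega)"
      by (rule nn_integral_cmult) (intro borel_measurable_Omega, simp)
    also have "(\<integral>\<^sup>+x. ennreal (2 ^ m) * indicator (cell m t) x \<partial>Omega) = ennreal (avg m (\<lambda>_. 1) t)"
      by (simp add: ennreal_avg)
    also have "\<dots> = 1" using avg_const[OF t] by simp
    finally show "(\<integral>\<^sup>+x. indicator A x * (ennreal (2 ^ m) * (k (x, t) * ennreal (F t))) \<partial>Omega)
        = indicator A t * ennreal (F t)" by simp
  qed
  finally show ?thesis .
qed

section \<open>A weak type inequality\<close>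

text \<open>
  The points at which the averages of \<open>F\<close> exceed \<open>l\<close> for the first time at level \<open>s\<close>: a stopping
  time decomposition of the set where the dyadic maximal function is larger than \<open>l\<close>.
\<close>

definition first_exceed :: "(real \<Rightarrow> real) \<Rightarrow> real \<Rightarrow> nat \<Rightarrow> real set" where
  "first_exceed F l s = {x. l < avg s F x \<and> (\<forall>r<s. avg r F x \<le> l)}"

lemma first_exceed_sets [measurable]: "first_exceed F l s \<in> sets borel"
proof -
  have "{x \<in> space borel. l < avg s F x \<and> (\<forall>r<s. avg r F x \<le> l)} \<in> sets borel"
    by measurable
  then show ?thesis by (simp add: first_exceed_def)
qed

lemma first_exceed_cong:
  assumes "s \<le> m" "t \<in> cell m x"
  shows "t \<in> first_exceed F l s \<longleftrightarrow> x \<in> first_exceed F l s"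
proof -
  have "avg r F t = avg r F x" if "r \<le> s" for r
    using assms that cell_antimono[of r m x] by (intro avg_cell_cong) auto
  then show ?thesis by (simp add: first_exceed_def)
qed

lemma first_exceed_disjoint: "x \<in> first_exceed F l s \<Longrightarrow> x \<in> first_exceed F l r \<Longrightarrow> r = s"
  by (auto simp: first_exceed_def) (metis linorder_neqE_nat not_less)

lemma first_exceed_exists:
  assumes "l < avg m F x"
  shows "\<exists>s\<le>m. x \<in> first_exceed F l s"
proof -
  define s where "s = (LEAST s. l < avg s F x)"
  have "l < avg s F x" unfolding s_def using assms by (rule LeastI)
  moreover have "s \<le> m" unfolding s_def using assms by (rule Least_le)
  moreover have "avg r F x \<le> l" if "r < s" for r
    using not_less_Least[OF that[unfolded s_def]] by simp
  ultimately show ?thesis by (auto simp: first_exceed_def)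
qed

text \<open>
  The part of \<open>flip_sum m F x / 2 ^ m\<close> that comes from flipped points \<open>flip j x\<close> whose averages
  exceed \<open>l\<close> for the first time strictly between the levels \<open>j\<close> and \<open>m\<close>.
\<close>

definition off_sum :: "(real \<Rightarrow> real) \<Rightarrow> real \<Rightarrow> nat \<Rightarrow> real \<Rightarrow> real" where
  "off_sum F l m x = (\<Sum>j\<le>m. \<Sum>s\<in>{j<..<m}.
     2 ^ j / 2 ^ m * (indicator (first_exceed F l s) (flip j x) * avg m F (flip j x)))"

text \<open>
  If no average around \<open>x\<close> exceeds \<open>l\<close>, then the averages around \<open>flip j x\<close> up to level \<open>j\<close> do
  not either, because they are the same. At the first level of excess they are still at most \<open>2 l\<close>.
\<close>

lemma flip_sum_le_off_sum:
  assumes F: "integrable Omega F" "\<And>x. 0 \<le> F x"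
    and l: "\<And>s. avg s F x \<le> l"
  shows "flip_sum m F x / 2 ^ m \<le> 4 * l + off_sum F l m x"
proof -
  have l0: "0 \<le> l" using avg_nonneg[of F 0 x, OF F(2)] l[of 0] by linarith
  have pos: "0 \<le> indicator (first_exceed F l s) y * avg m F y" for s y
    by (intro mult_nonneg_nonneg avg_nonneg F) simp
  have S: "0 \<le> (\<Sum>s\<in>{j<..<m}. indicator (first_exceed F l s) y * avg m F y)" for y j
    by (intro sum_nonneg pos)
  have key: "avg m F y \<le> 2 * l + (\<Sum>s\<in>{j<..<m}. indicator (first_exceed F l s) y * avg m F y)"
    if y: "y = flip j x" for y j
  proof (cases "avg m F y \<le> l")
    case True
    then show ?thesis using l0 S[of y j] by linarith
  next
    case False
    then obtain s where s: "s \<le> m" "y \<in> first_exceed F l s"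
      using first_exceed_exists[of l m F y] by auto
    have js: "j < s"
    proof (rule ccontr)
      assume "\<not> j < s"
      then have "avg s F y = avg s F x" unfolding y by (simp add: avg_flip)
      then show False using l[of s] s(2) by (auto simp: first_exceed_def)
    qed
    show ?thesis
    proof (cases "s = m")
      case True
      obtain r where r: "m = Suc r" using js True by (cases m) auto
      have "avg m F y \<le> 2 * avg r F y" unfolding r by (rule avg_double[OF F])
      also have "\<dots> \<le> 2 * l" using s True r by (auto simp: first_exceed_def)
      finally show ?thesis using S[of y j] by linarith
    next
      case False
      have "avg m F y = indicator (first_exceed F l s) y * avg m F y" using s by simp
      also have "\<dots> \<le> (\<Sum>s\<in>{j<..<m}. indicator (first_exceed F l s) y * avg m F y)"
        by (rule member_le_sum) (use False s js pos in auto)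
      finally show ?thesis using l0 by simp
    qed
  qed
  have "(\<Sum>j\<le>m. (2::real) ^ j) = 2 ^ Suc m - 1"
    by (induction m) auto
  then have geo: "(\<Sum>j\<le>m. 2 ^ j / 2 ^ m) \<le> (2::real)"
    by (simp add: sum_divide_distrib[symmetric] field_simps)
  have "flip_sum m F x / 2 ^ m = (\<Sum>j\<le>m. 2 ^ j / 2 ^ m * avg m F (flip j x))"
    by (simp add: flip_sum_def sum_divide_distrib)
  also have "\<dots> \<le> (\<Sum>j\<le>m. 2 ^ j / 2 ^ m *
      (2 * l + (\<Sum>s\<in>{j<..<m}. indicator (first_exceed F l s) (flip j x) * avg m F (flip j x))))"
    by (intro sum_mono mult_left_mono key) auto
  also have "\<dots> = (\<Sum>j\<le>m. 2 ^ j / 2 ^ m) * (2 * l) + off_sum F l m x"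
    unfolding off_sum_def by (simp only: distrib_left sum.distrib sum_distrib_right sum_distrib_left)
  also have "\<dots> \<le> 2 * (2 * l) + off_sum F l m x"
    using geo l0 by (intro add_right_mono mult_right_mono) auto
  finally show ?thesis by simp
qed

lemma sum_geometric_double_le:
  fixes a :: "nat \<Rightarrow> real"
  assumes "\<And>s. 0 \<le> a s"
  shows "(\<Sum>m\<le>M. \<Sum>s<m. 2 ^ s / 2 ^ m * a s) \<le> (\<Sum>s<M. a s)"
proof -
  \<comment> \<open>The inner sums satisfy a two-term recursion, which telescopes.\<close>
  define b where "b m = (\<Sum>s<m. 2 ^ s / 2 ^ m * a s)" for m
  have b_Suc: "b (Suc m) = (b m + a m) / 2" for m
    by (simp add: b_def add_divide_distrib sum_divide_distrib mult.commute)
  have "(\<Sum>m\<le>M. b m) + b M = (\<Sum>s<M. a s)"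
    by (induction M) (simp_all add: b_Suc b_def[of 0])
  moreover have "0 \<le> b M" unfolding b_def by (intro sum_nonneg mult_nonneg_nonneg assms) auto
  ultimately show ?thesis by (simp add: b_def)
qed

lemma flip_sum_measurable [measurable]: "flip_sum m F \<in> borel_measurable borel"
proof -
  have "(\<lambda>x. flip_sum m F x) \<in> borel_measurable borel"
    unfolding flip_sum_def by measurable
  then show ?thesis by simp
qed

lemma ennreal_le_suminf: "f s \<le> (\<Sum>s. f s)" for f :: "nat \<Rightarrow> ennreal"
  using sum_le_suminf[of f "{s}"] by simp

text \<open>
  Weak type (1,1) of the maximal operator of \<open>flip_sum m F / 2 ^ m\<close>. The points where some average
  exceeds \<open>l\<close> are handled as in Doob's inequality. At the other points \<open>flip_sum_le_off_sum\<close>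
  applies, and \<open>off_sum\<close> has small total integral: the excess at level \<open>s\<close> enters with weights
  \<open>2 ^ (j - m)\<close>, \<open>j < s < m\<close>, whose sum is at most 1.
\<close>

lemma flip_sum_weak_type:
  assumes F: "integrable Omega F" "\<And>x. 0 \<le> F x" and l: "0 < l"
  shows "measure Omega {x \<in> {0..<1}. \<exists>m. 5 * l < flip_sum m F x / 2 ^ m}
    \<le> 2 * (\<integral>x. F x \<partial>Omega) / l"
proof -
  let ?E = "first_exceed F l"
  define a where "a s = (\<integral>x. indicator (?E s) x * F x \<partial>Omega)" for s
  have int_E: "integrable Omega (\<lambda>x. indicator (?E s) x * F x)" for s
    by (rule integrable_mult_bounded[OF F(1)]) (auto simp: indicator_def)
  have a_pos: "0 \<le> a s" for s
    unfolding a_def using F by (intro Bochner_Integration.integral_nonneg) auto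
  have a_nn: "(\<integral>\<^sup>+x. indicator (?E s) x * ennreal (avg m F x) \<partial>Omega) = ennreal (a s)" if "s \<le> m" for s m
  proof -
    have "(\<integral>\<^sup>+x. indicator (?E s) x * ennreal (avg m F x) \<partial>Omega)
        = (\<integral>\<^sup>+x. indicator (?E s) x * ennreal (F x) \<partial>Omega)"
      by (rule nn_integral_avg[OF F]) (use first_exceed_cong[OF that] in auto)
    also have "\<dots> = (\<integral>\<^sup>+x. ennreal (indicator (?E s) x * F x) \<partial>Omega)"
      using F(2) by (intro nn_integral_cong) (auto simp: indicator_def)
    also have "\<dots> = ennreal (a s)"
      unfolding a_def using int_E F(2) by (intro nn_integral_eq_integral) auto
    finally show ?thesis .
  qed
  have a_sum: "(\<Sum>s<M. a s) \<le> (\<integral>x. F x \<partial>Omega)" for M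
  proof -
    have "(\<Sum>s<M. a s) = (\<integral>x. (\<Sum>s<M. indicator (?E s) x * F x) \<partial>Omega)"
      unfolding a_def by (rule Bochner_Integration.integral_sum[symmetric]) (rule int_E)
    also have "\<dots> \<le> (\<integral>x. F x \<partial>Omega)"
    proof (rule integral_mono)
      fix x
      show "(\<Sum>s<M. indicator (?E s) x * F x) \<le> F x"
      proof (cases "\<exists>s<M. x \<in> ?E s")
        case True
        then obtain s where s: "s < M" "x \<in> ?E s" by auto
        have "(\<Sum>s<M. indicator (?E s) x * F x) = (\<Sum>r\<in>{s}. indicator (?E r) x * F x)"
        proof (rule sum.mono_neutral_right)
          show "\<forall>r\<in>{..<M} - {s}. indicator (?E r) x * F x = 0"
          proof
            fix r assume "r \<in> {..<M} - {s}"
            then have "x \<notin> ?E r" using first_exceed_disjoint[OF s(2), of r] by blast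
            then show "indicator (?E r) x * F x = 0" by simp
          qed
        qed (use s in auto)
        also have "\<dots> = F x" using s by simp
        finally show ?thesis by (simp only: order_refl)
      next
        case False
        then have "(\<Sum>s<M. indicator (?E s) x * F x) = 0"
          by (intro sum.neutral) auto
        then show ?thesis using F(2)[of x] by (simp only:)
      qed
    qed (rule Bochner_Integration.integrable_sum int_E F)+
    finally show ?thesis .
  qed
  have off_pos: "0 \<le> off_sum F l m x" for m x
    unfolding off_sum_def by (intro sum_nonneg mult_nonneg_nonneg avg_nonneg F) auto
  have off_meas [measurable]: "off_sum F l m \<in> borel_measurable borel" for m
  proof -
    have "(\<lambda>x. off_sum F l m x) \<in> borel_measurable borel"
      unfolding off_sum_def by measurable
    then show ?thesis by simp
  qed
  have off_int: "(\<integral>\<^sup>+x. ennreal (off_sum F l m x) \<partial>Omega) \<le> ennreal (\<Sum>s<m. 2 ^ s / 2 ^ m * a s)" for m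
  proof -
    have "(\<integral>\<^sup>+x. ennreal (off_sum F l m x) \<partial>Omega)
      = (\<integral>\<^sup>+x. (\<Sum>j\<le>m. \<Sum>s\<in>{j<..<m}. ennreal (2 ^ j / 2 ^ m) *
          (indicator (?E s) (flip j x) * ennreal (avg m F (flip j x)))) \<partial>Omega)"
    proof (rule nn_integral_cong)
      fix x
      define t where "t j s = 2 ^ j / 2 ^ m * (indicator (?E s) (flip j x) * avg m F (flip j x))" for j s
      have t_pos: "0 \<le> t j s" for j s
        unfolding t_def by (intro mult_nonneg_nonneg avg_nonneg F) auto
      have t: "ennreal (2 ^ j / 2 ^ m) * (indicator (?E s) (flip j x) * ennreal (avg m F (flip j x))) = ennreal (t j s)" for j s
        using avg_nonneg[of F m "flip j x", OF F(2)]
        by (cases "flip j x \<in> ?E s") (simp_all add: ennreal_mult[symmetric] t_def)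
      show "ennreal (off_sum F l m x) = (\<Sum>j\<le>m. \<Sum>s\<in>{j<..<m}. ennreal (2 ^ j / 2 ^ m) *
          (indicator (?E s) (flip j x) * ennreal (avg m F (flip j x))))"
        unfolding t off_sum_def t_def[symmetric] by (simp add: t_pos sum_nonneg)
    qed
    also have "\<dots> = (\<Sum>j\<le>m. \<Sum>s\<in>{j<..<m}. ennreal (2 ^ j / 2 ^ m) *
        (\<integral>\<^sup>+x. indicator (?E s) (flip j x) * ennreal (avg m F (flip j x)) \<partial>Omega))"
    proof -
      have [measurable]: "(\<lambda>x. indicator (?E s) (flip j x) * ennreal (avg m F (flip j x))) \<in> borel_measurable Omega" for s j
        by (rule borel_measurable_Omega) measurable
      show ?thesis
        by (simp add: nn_integral_sum nn_integral_cmult)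
    qed
    also have "\<dots> = (\<Sum>j\<le>m. \<Sum>s\<in>{j<..<m}. ennreal (2 ^ j / 2 ^ m) * ennreal (a s))"
    proof (intro sum.cong refl arg_cong2[where f = "(*)"])
      fix j s assume "s \<in> {j<..<m}"
      then show "(\<integral>\<^sup>+x. indicator (?E s) (flip j x) * ennreal (avg m F (flip j x)) \<partial>Omega) = ennreal (a s)"
        using a_nn[of s m] by (subst nn_integral_flip[of "\<lambda>y. indicator (?E s) y * ennreal (avg m F y)" j]) auto
    qed
    also have "\<dots> = (\<Sum>j\<le>m. \<Sum>s\<in>{j<..<m}. ennreal (2 ^ j / 2 ^ m * a s))"
      by (intro sum.cong refl ennreal_mult[symmetric] a_pos) simp
    also have "\<dots> = ennreal (\<Sum>j\<le>m. \<Sum>s\<in>{j<..<m}. 2 ^ j / 2 ^ m * a s)"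
      using a_pos by (simp add: sum_nonneg)
    also have "(\<Sum>j\<le>m. \<Sum>s\<in>{j<..<m}. 2 ^ j / 2 ^ m * a s)
        = (\<Sum>s<m. \<Sum>j<s. 2 ^ j / 2 ^ m * a s)"
    proof -
      have 1: "{s \<in> {..<m}. j < s} = {j<..<m}" for j by auto
      have 2: "{j \<in> {..m}. j < s} = {..<s}" if "s \<in> {..<m}" for s using that by auto
      have "(\<Sum>j\<le>m. \<Sum>s\<in>{j<..<m}. 2 ^ j / 2 ^ m * a s)
          = (\<Sum>s<m. \<Sum>j\<in>{j \<in> {..m}. j < s}. 2 ^ j / 2 ^ m * a s)"
        using sum.swap_restrict[of "{..m}" "{..<m}" "\<lambda>j s. 2 ^ j / 2 ^ m * a s" "\<lambda>j s. j < s"]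
        unfolding 1 by (simp only: finite_atMost finite_lessThan)
      also have "\<dots> = (\<Sum>s<m. \<Sum>j<s. 2 ^ j / 2 ^ m * a s)"
        by (intro sum.cong 2 refl)
      finally show ?thesis .
    qed
    also have "\<dots> \<le> (\<Sum>s<m. 2 ^ s / 2 ^ m * a s)"
    proof (rule sum_mono)
      fix s
      have "(\<Sum>j<s. (2::real) ^ j) = 2 ^ s - 1" by (induction s) auto
      then have "(\<Sum>j<s. 2 ^ j / 2 ^ m * a s) = (2 ^ s - 1) / 2 ^ m * a s"
        by (simp add: sum_distrib_right[symmetric] sum_divide_distrib[symmetric])
      also have "\<dots> \<le> 2 ^ s / 2 ^ m * a s"
        using a_pos by (intro mult_right_mono divide_right_mono) auto
      finally show "(\<Sum>j<s. 2 ^ j / 2 ^ m * a s) \<le> 2 ^ s / 2 ^ m * a s" .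
    qed
    finally show ?thesis by (simp add: ennreal_leI)
  qed
  let ?B = "{x \<in> {0..<1}. \<exists>m. 5 * l < flip_sum m F x / 2 ^ m}"
  let ?I = "\<integral>x. F x \<partial>Omega"
  have B_sets: "?B \<in> sets borel" by measurable
  \<comment> \<open>Both kinds of points are covered by a single integrable majorant of the indicator.\<close>
  have pt: "ennreal l * indicator ?B x \<le> (\<Sum>s. indicator (?E s) x * ennreal (avg s F x))
      + (\<Sum>m. ennreal (off_sum F l m x))" for x
  proof (cases "x \<in> ?B")
    case True
    show ?thesis
    proof (cases "\<exists>s. l < avg s F x")
      case True
      then obtain s where s: "x \<in> ?E s" using first_exceed_exists by blast
      have "ennreal l * indicator ?B x \<le> ennreal l" by (simp add: indicator_def)
      also have "\<dots> \<le> indicator (?E s) x * ennreal (avg s F x)"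
        using s by (auto simp: first_exceed_def intro!: ennreal_leI)
      also have "\<dots> \<le> (\<Sum>s. indicator (?E s) x * ennreal (avg s F x))"
        by (rule ennreal_le_suminf)
      finally show ?thesis by (rule order_trans) simp
    next
      case False
      from \<open>x \<in> ?B\<close> obtain m where m: "5 * l < flip_sum m F x / 2 ^ m" by auto
      have "l \<le> off_sum F l m x"
        using flip_sum_le_off_sum[OF F, of x l m] False m by (auto simp: not_less)
      have "ennreal l * indicator ?B x \<le> ennreal l" by (simp add: indicator_def)
      also have "\<dots> \<le> ennreal (off_sum F l m x)" by (rule ennreal_leI) fact
      also have "\<dots> \<le> (\<Sum>m. ennreal (off_sum F l m x))"
        by (rule ennreal_le_suminf)
      finally show ?thesis by (rule order_trans) simp
    qed
  qed simp
  have "ennreal l * emeasure Omega ?B = (\<integral>\<^sup>+x. ennreal l * indicator ?B x \<partial>Omega)"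
    using B_sets by (intro nn_integral_cmult_indicator[symmetric])
       (auto simp: Omega_def sets_restrict_space_iff)
  also have "\<dots> \<le> (\<integral>\<^sup>+x. (\<Sum>s. indicator (?E s) x * ennreal (avg s F x))
      + (\<Sum>m. ennreal (off_sum F l m x)) \<partial>Omega)"
    by (intro nn_integral_mono pt)
  also have "\<dots> = (\<Sum>s. \<integral>\<^sup>+x. indicator (?E s) x * ennreal (avg s F x) \<partial>Omega)
      + (\<Sum>m. \<integral>\<^sup>+x. ennreal (off_sum F l m x) \<partial>Omega)"
  proof -
    have [measurable]: "(\<lambda>x. indicator (?E s) x * ennreal (avg s F x)) \<in> borel_measurable Omega" for s
      by (rule borel_measurable_Omega) measurable
    have [measurable]: "(\<lambda>x. ennreal (off_sum F l m x)) \<in> borel_measurable Omega" for m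
      by (rule borel_measurable_Omega) measurable
    show ?thesis by (subst nn_integral_add) (simp_all add: nn_integral_suminf)
  qed
  also have "\<dots> \<le> ennreal ?I + ennreal ?I"
  proof (rule add_mono)
    show "(\<Sum>s. \<integral>\<^sup>+x. indicator (?E s) x * ennreal (avg s F x) \<partial>Omega) \<le> ennreal ?I"
    proof (rule suminf_le_const[OF summableI])
      fix M
      show "(\<Sum>s<M. \<integral>\<^sup>+x. indicator (?E s) x * ennreal (avg s F x) \<partial>Omega) \<le> ennreal ?I"
        using a_sum[of M] a_pos by (simp add: a_nn ennreal_leI)
    qed
    show "(\<Sum>m. \<integral>\<^sup>+x. ennreal (off_sum F l m x) \<partial>Omega) \<le> ennreal ?I"
    proof (rule suminf_le_const[OF summableI])
      fix M
      have "(\<Sum>m<M. \<integral>\<^sup>+x. ennreal (off_sum F l m x) \<partial>Omega)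
          \<le> (\<Sum>m\<le>M. ennreal (\<Sum>s<m. 2 ^ s / 2 ^ m * a s))"
        by (rule order_trans[OF sum_mono[OF off_int]]) (rule sum_mono2; auto)
      also have "\<dots> = ennreal (\<Sum>m\<le>M. \<Sum>s<m. 2 ^ s / 2 ^ m * a s)"
        using a_pos by (simp add: sum_nonneg)
      also have "\<dots> \<le> ennreal ?I"
        by (intro ennreal_leI order_trans[OF sum_geometric_double_le a_sum] a_pos)
      finally show "(\<Sum>m<M. \<integral>\<^sup>+x. ennreal (off_sum F l m x) \<partial>Omega) \<le> ennreal ?I" .
    qed
  qed
  also have "\<dots> = ennreal (2 * ?I)"
    using F(2) by (subst ennreal_plus[symmetric]) (auto intro!: Bochner_Integration.integral_nonneg)
  finally have "ennreal (l * measure Omega ?B) \<le> ennreal (2 * ?I)"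
    using l by (simp add: Omega.emeasure_eq_measure ennreal_mult)
  moreover have "0 \<le> ?I" using F(2) by (intro Bochner_Integration.integral_nonneg) auto
  ultimately have "l * measure Omega ?B \<le> 2 * ?I" by (subst (asm) ennreal_le_iff) auto
  then show ?thesis using l by (simp add: field_simps)
qed

section \<open>Lebesgue points for flipped averages\<close>

lemma L1_approx_continuous:
  fixes F :: "real \<Rightarrow> real" and e :: real
  assumes F: "integrable Omega F" and e: "0 < e"
  shows "\<exists>\<phi> B. continuous_on UNIV \<phi> \<and> (\<forall>x. \<bar>\<phi> x\<bar> \<le> B) \<and> (\<integral>x. \<bar>F x - \<phi> x\<bar> \<partial>Omega) < e"
proof -
  \<comment> \<open>Truncation at height \<open>B\<close> makes dominated convergence applicable.\<close>
  define c where "c B y = max (- B) (min B y)" for B y :: real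
  have c_cont: "continuous_on UNIV (c B)" for B
    unfolding c_def by (intro continuous_intros)
  have c_meas [measurable]: "c B \<in> borel_measurable borel" for B
    using c_cont by (rule borel_measurable_continuous_onI)
  have [measurable]: "F \<in> borel_measurable Omega" using F by auto
  have "F measurable_on {0..<1}"
    using \<open>F \<in> borel_measurable Omega\<close>
    by (intro measurable_on_iff_borel_measurable[THEN iffD2]) (auto simp: Omega_def)
  then obtain N g where N: "negligible N" and g: "\<And>n. continuous_on UNIV (g n)"
    and lim: "\<And>x. x \<notin> N \<Longrightarrow> (\<lambda>n::nat. g n x) \<longlonglongrightarrow> (if x \<in> {0..<1} then F x else 0)"
    unfolding measurable_on_def by blast
  have g_meas [measurable]: "g n \<in> borel_measurable Omega" for n
    by (intro borel_measurable_Omega borel_measurable_continuous_onI g)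
  have AE_lim: "AE x in Omega. (\<lambda>n. g n x) \<longlonglongrightarrow> F x"
  proof -
    have "AE x in lebesgue. x \<notin> N"
      using N by (auto simp: negligible_iff_null_sets intro: AE_not_in)
    then have "AE x in Omega. x \<notin> N"
      unfolding Omega_def by (subst AE_restrict_space_iff) auto
    moreover have "AE x in Omega. x \<in> {0..<1}" by (rule AE_I2) simp
    ultimately show ?thesis
      by eventually_elim (drule lim, simp)
  qed
  have "(\<lambda>n. \<integral>x. \<bar>F x - c (real n) (F x)\<bar> \<partial>Omega) \<longlonglongrightarrow> (\<integral>x. 0 \<partial>Omega)"
  proof (rule integral_dominated_convergence[where w = "\<lambda>x. \<bar>F x\<bar>"])
    show "AE x in Omega. (\<lambda>n. \<bar>F x - c (real n) (F x)\<bar>) \<longlonglongrightarrow> 0"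
    proof (rule AE_I2)
      fix x
      have "\<forall>\<^sub>F n in sequentially. \<bar>F x - c (real n) (F x)\<bar> = 0"
      proof (rule eventually_sequentiallyI)
        fix n assume "nat \<lceil>\<bar>F x\<bar>\<rceil> \<le> n"
        then have "\<bar>F x\<bar> \<le> real n" by linarith
        then show "\<bar>F x - c (real n) (F x)\<bar> = 0" by (auto simp: c_def)
      qed
      then show "(\<lambda>n. \<bar>F x - c (real n) (F x)\<bar>) \<longlonglongrightarrow> 0" by (rule tendsto_eventually)
    qed
    show "AE x in Omega. norm \<bar>F x - c (real n) (F x)\<bar> \<le> \<bar>F x\<bar>" for n
      by (rule AE_I2) (auto simp: c_def)
  qed (use F in auto)
  then have "\<forall>\<^sub>F n in sequentially. (\<integral>x. \<bar>F x - c (real n) (F x)\<bar> \<partial>Omega) < e / 2"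
    using e by (intro order_tendstoD) auto
  then obtain B where B: "(\<integral>x. \<bar>F x - c (real B) (F x)\<bar> \<partial>Omega) < e / 2"
    by (auto simp: eventually_sequentially)
  have c_bound: "\<bar>c (real B) y\<bar> \<le> real B" for y by (auto simp: c_def)
  have "(\<lambda>n. \<integral>x. \<bar>c (real B) (F x) - c (real B) (g n x)\<bar> \<partial>Omega) \<longlonglongrightarrow> (\<integral>x. 0 \<partial>Omega)"
  proof (rule integral_dominated_convergence[where w = "\<lambda>x. 2 * real B"])
    show "AE x in Omega. (\<lambda>n. \<bar>c (real B) (F x) - c (real B) (g n x)\<bar>) \<longlonglongrightarrow> 0"
      using AE_lim
    proof eventually_elim
      case (elim x)
      have "isCont (c (real B)) (F x)" using c_cont by (simp add: continuous_on_eq_continuous_at)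
      then have "(\<lambda>n. c (real B) (g n x)) \<longlonglongrightarrow> c (real B) (F x)"
        using elim by (rule isCont_tendsto_compose)
      then have "(\<lambda>n. \<bar>c (real B) (F x) - c (real B) (g n x)\<bar>) \<longlonglongrightarrow> \<bar>c (real B) (F x) - c (real B) (F x)\<bar>"
        by (intro tendsto_intros)
      then show ?case by simp
    qed
    show "AE x in Omega. norm \<bar>c (real B) (F x) - c (real B) (g n x)\<bar> \<le> 2 * real B" for n
    proof (rule AE_I2)
      fix x show "norm \<bar>c (real B) (F x) - c (real B) (g n x)\<bar> \<le> 2 * real B"
        using c_bound[of "F x"] c_bound[of "g n x"] by simp
    qed
  qed auto
  then have "\<forall>\<^sub>F n in sequentially. (\<integral>x. \<bar>c (real B) (F x) - c (real B) (g n x)\<bar> \<partial>Omega) < e / 2"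
    using e by (intro order_tendstoD) auto
  then obtain n where n: "(\<integral>x. \<bar>c (real B) (F x) - c (real B) (g n x)\<bar> \<partial>Omega) < e / 2"
    by (auto simp: eventually_sequentially)
  have int_c: "integrable Omega (\<lambda>x. c (real B) (h x))" if [measurable]: "h \<in> borel_measurable Omega" for h
    by (rule Omega.integrable_const_bound[where B = "real B"]) (use c_bound in auto)
  have "(\<integral>x. \<bar>F x - c (real B) (g n x)\<bar> \<partial>Omega)
      \<le> (\<integral>x. \<bar>F x - c (real B) (F x)\<bar> + \<bar>c (real B) (F x) - c (real B) (g n x)\<bar> \<partial>Omega)"
    by (intro integral_mono Bochner_Integration.integrable_add Bochner_Integration.integrable_diff
          integrable_abs F int_c g_meas) auto
  also have "\<dots> = (\<integral>x. \<bar>F x - c (real B) (F x)\<bar> \<partial>Omega)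
      + (\<integral>x. \<bar>c (real B) (F x) - c (real B) (g n x)\<bar> \<partial>Omega)"
    by (intro Bochner_Integration.integral_add Bochner_Integration.integrable_diff
          integrable_abs F int_c g_meas) auto
  also have "\<dots> < e" using B n by simp
  finally have "(\<integral>x. \<bar>F x - c (real B) (g n x)\<bar> \<partial>Omega) < e" .
  moreover have "continuous_on UNIV (\<lambda>x. c (real B) (g n x))"
    by (rule continuous_on_compose2[OF c_cont g]) auto
  ultimately show ?thesis using c_bound by blast
qed

lemma avg_le:
  assumes "integrable Omega G" "y \<in> {0..<1}" "\<And>t. t \<in> cell m y \<Longrightarrow> G t \<le> c"
  shows "avg m G y \<le> c"
  using avg_mono[of G "\<lambda>_. c" m y] assms avg_const[of y m c] by auto

lemma flip_sum_mono:
  assumes "integrable Omega F" "integrable Omega G" "\<And>t. F t \<le> G t"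
  shows "flip_sum m F x \<le> flip_sum m G x"
  unfolding flip_sum_def by (intro sum_mono mult_left_mono avg_mono) (use assms in auto)

lemma flip_sum_add:
  assumes "integrable Omega F" "integrable Omega G"
  shows "flip_sum m (\<lambda>t. F t + G t) x = flip_sum m F x + flip_sum m G x"
  unfolding flip_sum_def by (simp add: avg_add[OF assms] distrib_left sum.distrib)

lemma sum_power2_atMost: "(\<Sum>j\<le>m. (2::real) ^ j) = 2 * 2 ^ m - 1"
  by (induction m) auto

lemma flip_sum_const_le:
  assumes "x \<in> {0..<1}" "0 \<le> c"
  shows "flip_sum m (\<lambda>_. c) x / 2 ^ m \<le> 2 * c"
proof -
  have "flip_sum m (\<lambda>_. c) x = (\<Sum>j\<le>m. 2 ^ j) * c"
    unfolding flip_sum_def sum_distrib_right using assms by (simp add: avg_const)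
  also have "\<dots> \<le> 2 * 2 ^ m * c"
    unfolding sum_power2_atMost using assms by (intro mult_right_mono) auto
  finally show ?thesis by (simp add: field_simps)
qed

lemma integrable_bounded_continuous:
  fixes \<phi> :: "real \<Rightarrow> real"
  assumes "continuous_on UNIV \<phi>" "\<And>x. \<bar>\<phi> x\<bar> \<le> B"
  shows "integrable Omega \<phi>"
proof (rule Omega.integrable_const_bound[where B = B])
  show "\<phi> \<in> borel_measurable Omega"
    by (intro borel_measurable_Omega borel_measurable_continuous_onI assms)
qed (use assms in auto)

lemma mem_cell_imp_dist:
  assumes "t \<in> cell m x"
  shows "\<bar>t - x\<bar> < 1 / 2 ^ m"
proof -
  have "\<lfloor>2 ^ m * t\<rfloor> = \<lfloor>2 ^ m * x\<rfloor>" using assms by (simp add: cell_def)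
  then have "\<bar>2 ^ m * t - 2 ^ m * x\<bar> < 1" by linarith
  then have "2 ^ m * \<bar>t - x\<bar> < 1" by (simp add: right_diff_distrib[symmetric] abs_mult)
  then show ?thesis by (simp add: field_simps)
qed

lemma flip_sum_continuous_tendsto:
  fixes \<phi> :: "real \<Rightarrow> real"
  assumes \<phi>: "continuous_on UNIV \<phi>" "\<And>x. \<bar>\<phi> x\<bar> \<le> B" and x: "x \<in> {0..<1}"
  shows "(\<lambda>m. flip_sum m (\<lambda>t. \<bar>\<phi> t - \<phi> x\<bar>) x / 2 ^ m) \<longlonglongrightarrow> 0"
proof (rule LIMSEQ_I)
  fix e :: real assume e: "0 < e"
  let ?G = "\<lambda>t. \<bar>\<phi> t - \<phi> x\<bar>"
  have G: "integrable Omega ?G"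
    using integrable_bounded_continuous[OF \<phi>] by auto
  have B0: "0 \<le> B" using \<phi>(2)[of 0] by linarith
  have GB: "?G t \<le> 2 * B" for t using \<phi>(2)[of t] \<phi>(2)[of x] by linarith
  have "isCont \<phi> x" using \<phi> by (simp add: continuous_on_eq_continuous_at)
  then obtain d where d: "0 < d" "\<And>t. \<bar>t - x\<bar> < d \<Longrightarrow> ?G t < e / 8"
    unfolding continuous_at_eps_delta using e by (metis dist_real_def divide_pos_pos zero_less_numeral)
  obtain J where J: "1 / 2 ^ J < d"
    using d(1) real_arch_pow_inv[of d "1/2"] by (auto simp: power_one_over)
  have big: "avg m ?G (flip j x) \<le> e / 8" if "J \<le> j" "j \<le> m" for j m
  proof (rule avg_le[OF G])
    show "flip j x \<in> {0..<1}" using x by simp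
    fix t assume "t \<in> cell m (flip j x)"
    then have "t \<in> cell J (flip j x)" using that cell_antimono[of J m] by auto
    moreover have "flip j x \<in> cell J x" using that by (intro flip_mem_cell)
    ultimately have "t \<in> cell J x" using cell_eq by blast
    then have "\<bar>t - x\<bar> < d" using mem_cell_imp_dist[of t J x] J by linarith
    then show "?G t \<le> e / 8" using d(2)[of t] by linarith
  qed
  have small: "avg m ?G (flip j x) \<le> 2 * B" for j m
    by (rule avg_le[OF G]) (use x GB in auto)
  have bound: "flip_sum m ?G x \<le> 2 * 2 ^ m * (e / 8) + J * (2 ^ J * (2 * B))" for m
  proof -
    have "flip_sum m ?G x \<le> (\<Sum>j\<le>m. 2 ^ j * (e / 8) + (if j < J then 2 ^ J * (2 * B) else 0))"
      unfolding flip_sum_def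
    proof (rule sum_mono)
      fix j assume j: "j \<in> {..m}"
      show "2 ^ j * avg m ?G (flip j x) \<le> 2 ^ j * (e / 8) + (if j < J then 2 ^ J * (2 * B) else 0)"
      proof (cases "j < J")
        case True
        have "2 ^ j * avg m ?G (flip j x) \<le> 2 ^ J * (2 * B)"
          using True small B0 by (intro mult_mono power_increasing avg_nonneg) auto
        moreover have "0 \<le> 2 ^ j * (e / 8)" using e by simp
        ultimately show ?thesis using True by simp
      next
        case False
        then show ?thesis using big[of j m] j by simp
      qed
    qed
    also have "\<dots> = (\<Sum>j\<le>m. 2 ^ j) * (e / 8) + (\<Sum>j\<in>{..m} \<inter> {..<J}. 2 ^ J * (2 * B))"
      by (simp add: sum.distrib sum_distrib_right sum.If_cases lessThan_def)
    also have "\<dots> \<le> 2 * 2 ^ m * (e / 8) + (\<Sum>j\<in>{..<J}. 2 ^ J * (2 * B))"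
      unfolding sum_power2_atMost using e B0
      by (intro add_mono mult_right_mono sum_mono2) auto
    finally show ?thesis by simp
  qed
  have "(\<lambda>m. J * (2 ^ J * (2 * B)) * (1 / 2) ^ m) \<longlonglongrightarrow> J * (2 ^ J * (2 * B)) * 0"
    by (intro tendsto_mult_left LIMSEQ_power_zero) simp
  then have "\<forall>\<^sub>F m in sequentially. J * (2 ^ J * (2 * B)) * (1 / 2) ^ m < e / 2"
    using e by (intro order_tendstoD) auto
  then obtain M where M: "\<And>m. M \<le> m \<Longrightarrow> J * (2 ^ J * (2 * B)) * (1 / 2) ^ m < e / 2"
    by (auto simp: eventually_sequentially)
  show "\<exists>M. \<forall>m\<ge>M. norm (flip_sum m ?G x / 2 ^ m - 0) < e"
  proof (intro exI allI impI)
    fix m assume m: "M \<le> m"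
    have "0 \<le> flip_sum m ?G x"
      unfolding flip_sum_def by (intro sum_nonneg mult_nonneg_nonneg avg_nonneg) auto
    moreover have "flip_sum m ?G x / 2 ^ m \<le> (2 * 2 ^ m * (e / 8) + J * (2 ^ J * (2 * B))) / 2 ^ m"
      by (intro divide_right_mono bound) simp
    moreover have "(2 * 2 ^ m * (e / 8) + J * (2 ^ J * (2 * B))) / 2 ^ m
        = e / 4 + J * (2 ^ J * (2 * B)) * (1 / 2) ^ m"
      by (simp add: field_simps power_one_over)
    ultimately show "norm (flip_sum m ?G x / 2 ^ m - 0) < e"
      using M[OF m] e by simp
  qed
qed


text \<open>
  Almost every point is a Lebesgue point, even with respect to the averages around all flipped points.
  The claim holds for bounded continuous functions at every point of \<open>{0..<1}\<close>; the weak type inequality and the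
  Borel--Cantelli lemma transfer it to an integrable function along a rapidly convergent sequence of
  continuous approximations.
\<close>

lemma AE_flip_sum_tendsto:
  assumes F: "integrable Omega F"
  shows "AE x in Omega. (\<lambda>m. flip_sum m (\<lambda>t. \<bar>F t - F x\<bar>) x / 2 ^ m) \<longlonglongrightarrow> 0"
proof -
  have "\<exists>\<phi> B. continuous_on UNIV \<phi> \<and> (\<forall>x. \<bar>\<phi> x\<bar> \<le> B) \<and> (\<integral>x. \<bar>F x - \<phi> x\<bar> \<partial>Omega) < (1/4) ^ k" for k
    by (rule L1_approx_continuous[OF F]) simp
  then obtain \<phi> B where \<phi>: "\<And>k. continuous_on UNIV (\<phi> k)" "\<And>k x. \<bar>\<phi> k x\<bar> \<le> B k"
    and close: "\<And>k::nat. (\<integral>x. \<bar>F x - \<phi> k x\<bar> \<partial>Omega) < (1/4) ^ k"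
    by metis
  have \<phi>_int: "integrable Omega (\<phi> k)" for k
    by (rule integrable_bounded_continuous[OF \<phi>])
  have D_int: "integrable Omega (\<lambda>x. \<bar>F x - \<phi> k x\<bar>)" for k
    using F \<phi>_int by auto
  define Z where "Z k = {x \<in> {0..<1}. \<exists>m. 5 * (1/2) ^ k < flip_sum m (\<lambda>t. \<bar>F t - \<phi> k t\<bar>) x / 2 ^ m}
    \<union> {x \<in> space Omega. (1/2) ^ k \<le> \<bar>F x - \<phi> k x\<bar>}" for k
  have Z1: "{x \<in> {0..<1}. \<exists>m. 5 * (1/2) ^ k < flip_sum m (\<lambda>t. \<bar>F t - \<phi> k t\<bar>) x / 2 ^ m} \<in> sets Omega" for k
  proof -
    have "{x \<in> {0..<1}. \<exists>m. 5 * (1/2) ^ k < flip_sum m (\<lambda>t. \<bar>F t - \<phi> k t\<bar>) x / 2 ^ m} \<in> sets borel"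
      by measurable
    then show ?thesis by (auto simp: Omega_def sets_restrict_space_iff)
  qed
  have Z2: "{x \<in> space Omega. (1/2) ^ k \<le> \<bar>F x - \<phi> k x\<bar>} \<in> sets Omega" for k
    using borel_measurable_integrable[OF D_int[of k]] by measurable
  have Z_sets: "Z k \<in> sets Omega" for k unfolding Z_def using Z1 Z2 by (rule sets.Un)
  have Z_meas: "measure Omega (Z k) \<le> 3 * (1/2) ^ k" for k
  proof -
    have pow: "(1/4::real) ^ k = (1/2) ^ k * (1/2) ^ k" by (simp add: power_mult_distrib[symmetric])
    have "measure Omega {x \<in> {0..<1}. \<exists>m. 5 * (1/2) ^ k < flip_sum m (\<lambda>t. \<bar>F t - \<phi> k t\<bar>) x / 2 ^ m}
        \<le> 2 * (\<integral>x. \<bar>F x - \<phi> k x\<bar> \<partial>Omega) / (1/2) ^ k"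
      by (rule flip_sum_weak_type[OF D_int]) auto
    also have "\<dots> \<le> 2 * (1/4) ^ k / (1/2) ^ k"
      using close[of k] by (intro divide_right_mono mult_left_mono) auto
    also have "\<dots> = 2 * (1/2) ^ k" unfolding pow by simp
    finally have 1: "measure Omega {x \<in> {0..<1}. \<exists>m. 5 * (1/2) ^ k < flip_sum m (\<lambda>t. \<bar>F t - \<phi> k t\<bar>) x / 2 ^ m} \<le> 2 * (1/2) ^ k" .
    have "measure Omega {x \<in> space Omega. (1/2) ^ k \<le> \<bar>F x - \<phi> k x\<bar>} \<le> (\<integral>x. \<bar>F x - \<phi> k x\<bar> \<partial>Omega) / (1/2) ^ k"
      by (rule integral_Markov_inequality_measure[OF D_int, where A = "space Omega"]) (use sets.top[of Omega] in auto)
    also have "\<dots> \<le> (1/4) ^ k / (1/2) ^ k"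
      using close[of k] by (intro divide_right_mono) auto
    also have "\<dots> = (1/2) ^ k" unfolding pow by simp
    finally have 2: "measure Omega {x \<in> space Omega. (1/2) ^ k \<le> \<bar>F x - \<phi> k x\<bar>} \<le> (1/2) ^ k" .
    have "measure Omega (Z k) \<le> measure Omega {x \<in> {0..<1}. \<exists>m. 5 * (1/2) ^ k < flip_sum m (\<lambda>t. \<bar>F t - \<phi> k t\<bar>) x / 2 ^ m}
        + measure Omega {x \<in> space Omega. (1/2) ^ k \<le> \<bar>F x - \<phi> k x\<bar>}"
      unfolding Z_def by (rule measure_Un_le[OF Z1 Z2])
    then show ?thesis using 1 2 by linarith
  qed
  have "AE x in Omega. eventually (\<lambda>k. x \<in> space Omega - Z k) sequentially"
  proof (rule borel_cantelli_AE1[OF Z_sets])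
    show "emeasure Omega (Z k) < \<infinity>" for k by (simp add: Omega.emeasure_eq_measure)
    show "summable (\<lambda>k. measure Omega (Z k))"
    proof (rule summable_comparison_test)
      show "summable (\<lambda>k. 3 * (1/2::real) ^ k)" by (intro summable_mult summable_geometric) simp
      show "\<exists>N. \<forall>n\<ge>N. norm (measure Omega (Z n)) \<le> 3 * (1/2) ^ n"
        using Z_meas by auto
    qed
  qed
  then show ?thesis
  proof (eventually_elim, intro LIMSEQ_I)
    fix x and e :: real
    assume ev: "eventually (\<lambda>k. x \<in> space Omega - Z k) sequentially" and e: "0 < e"
    have "(\<lambda>k. 7 * (1/2::real) ^ k) \<longlonglongrightarrow> 7 * 0"
      by (intro tendsto_mult_left LIMSEQ_power_zero) simp
    then have "\<forall>\<^sub>F k in sequentially. 7 * (1/2::real) ^ k < e / 2"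
      by (rule order_tendstoD) (use e in simp)
    from eventually_conj[OF this ev] obtain k where k: "7 * (1/2::real) ^ k < e / 2"
      and xk: "x \<in> space Omega - Z k"
      by (auto simp: eventually_sequentially)
    have x: "x \<in> {0..<1}" using xk by simp
    have d1: "flip_sum m (\<lambda>t. \<bar>F t - \<phi> k t\<bar>) x / 2 ^ m \<le> 5 * (1/2) ^ k" for m
      using xk by (auto simp: Z_def not_less)
    have d2: "\<bar>F x - \<phi> k x\<bar> < (1/2) ^ k" using xk by (auto simp: Z_def not_le)
    have "(\<lambda>m. flip_sum m (\<lambda>t. \<bar>\<phi> k t - \<phi> k x\<bar>) x / 2 ^ m) \<longlonglongrightarrow> 0"
      by (rule flip_sum_continuous_tendsto[OF \<phi> x])
    then have "\<forall>\<^sub>F m in sequentially. flip_sum m (\<lambda>t. \<bar>\<phi> k t - \<phi> k x\<bar>) x / 2 ^ m < e / 2"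
      using e by (intro order_tendstoD) auto
    then obtain M where M: "\<And>m. M \<le> m \<Longrightarrow> flip_sum m (\<lambda>t. \<bar>\<phi> k t - \<phi> k x\<bar>) x / 2 ^ m < e / 2"
      by (auto simp: eventually_sequentially)
    show "\<exists>M. \<forall>m\<ge>M. norm (flip_sum m (\<lambda>t. \<bar>F t - F x\<bar>) x / 2 ^ m - 0) < e"
    proof (intro exI allI impI)
      fix m assume m: "M \<le> m"
      let ?a = "\<lambda>t. \<bar>F t - \<phi> k t\<bar>" and ?b = "\<lambda>t. \<bar>\<phi> k t - \<phi> k x\<bar>" and ?c = "\<lambda>t::real. \<bar>F x - \<phi> k x\<bar>"
      have b_int: "integrable Omega ?b" using \<phi>_int[of k] by auto
      have "flip_sum m (\<lambda>t. \<bar>F t - F x\<bar>) x \<le> flip_sum m (\<lambda>t. ?a t + (?b t + ?c t)) x"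
        by (rule flip_sum_mono) (use F D_int b_int in auto)
      also have "\<dots> = flip_sum m ?a x + (flip_sum m ?b x + flip_sum m ?c x)"
        using D_int b_int by (subst flip_sum_add; simp?) (subst flip_sum_add; simp)
      finally have "flip_sum m (\<lambda>t. \<bar>F t - F x\<bar>) x / 2 ^ m
          \<le> flip_sum m ?a x / 2 ^ m + (flip_sum m ?b x / 2 ^ m + flip_sum m ?c x / 2 ^ m)"
        unfolding add_divide_distrib[symmetric] by (rule divide_right_mono) simp
      moreover have "flip_sum m ?c x / 2 ^ m \<le> 2 * \<bar>F x - \<phi> k x\<bar>"
        by (rule flip_sum_const_le[OF x]) simp
      moreover have "0 \<le> flip_sum m (\<lambda>t. \<bar>F t - F x\<bar>) x / 2 ^ m"
        unfolding flip_sum_def by (intro sum_nonneg mult_nonneg_nonneg avg_nonneg divide_nonneg_nonneg) auto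
      moreover have "\<lbrakk>s \<le> a + (b + c); c \<le> 2 * d; 0 \<le> s; a \<le> 5 * q; d < q; b < e / 2; 7 * q < e / 2\<rbrakk>
          \<Longrightarrow> \<bar>s\<bar> < e" for s a b c d q :: real
        by linarith
      ultimately have "\<bar>flip_sum m (\<lambda>t. \<bar>F t - F x\<bar>) x / 2 ^ m\<bar> < e"
        using d1[of m] d2 M[OF m] k by blast
      then show "norm (flip_sum m (\<lambda>t. \<bar>F t - F x\<bar>) x / 2 ^ m - 0) < e"
        by simp
    qed
  qed
qed

lemma AE_avg_bounded:
  assumes F: "integrable Omega F" "\<And>x. 0 \<le> F x"
  shows "AE x in Omega. \<exists>R. \<forall>m. avg m F x \<le> R"
proof -
  let ?I = "\<integral>x. F x \<partial>Omega"
  define Z where "Z n = {x \<in> {0..<1}. \<exists>m. 5 * real (Suc n) < flip_sum m F x / 2 ^ m}" for n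
  have Z_sets [measurable]: "Z n \<in> sets Omega" for n
  proof -
    have "{x \<in> {0..<1}. \<exists>m. 5 * real (Suc n) < flip_sum m F x / 2 ^ m} \<in> sets borel"
      by measurable
    then show ?thesis by (auto simp: Omega_def sets_restrict_space_iff Z_def)
  qed
  have meas: "measure Omega (Z n) \<le> 2 * ?I / real (Suc n)" for n
    unfolding Z_def by (rule flip_sum_weak_type[OF F]) simp
  have "measure Omega (\<Inter>n. Z n) \<le> 0"
  proof (rule LIMSEQ_le_const)
    show "(\<lambda>n. 2 * ?I * inverse (real (Suc n))) \<longlonglongrightarrow> 0"
      using tendsto_mult_right_zero[OF LIMSEQ_inverse_real_of_nat] by simp
    show "\<exists>N. \<forall>n\<ge>N. measure Omega (\<Inter>n. Z n) \<le> 2 * ?I * inverse (real (Suc n))"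
    proof (intro exI allI impI)
      fix n
      have "measure Omega (\<Inter>n. Z n) \<le> measure Omega (Z n)"
        by (rule Omega.finite_measure_mono) auto
      then show "measure Omega (\<Inter>n. Z n) \<le> 2 * ?I * inverse (real (Suc n))"
        using meas[of n] by (simp add: divide_inverse)
    qed
  qed
  then have "measure Omega (\<Inter>n. Z n) = 0" by (simp only: measure_le_0_iff)
  then have "emeasure Omega (\<Inter>n. Z n) = 0"
    unfolding Omega.emeasure_eq_measure by simp
  then have "(\<Inter>n. Z n) \<in> null_sets Omega" using Z_sets by auto
  then have "AE x in Omega. x \<notin> (\<Inter>n. Z n)" by (rule AE_not_in)
  moreover have "AE x in Omega. x \<in> {0..<1}" by (rule AE_I2) simp
  ultimately show ?thesis
  proof eventually_elim
    case (elim x)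
    then obtain n where n: "x \<notin> Z n" by auto
    have "avg m F x \<le> 5 * real (Suc n)" for m
    proof -
      have "2 ^ m * avg m F x \<le> flip_sum m F x" by (rule flip_sum_ge) (rule F)
      then have "avg m F x \<le> flip_sum m F x / 2 ^ m" by (simp add: field_simps)
      also have "\<dots> \<le> 5 * real (Suc n)"
        using n elim(2) unfolding Z_def by (auto simp: not_less)
      finally show ?thesis .
    qed
    then show ?case by blast
  qed
qed

section \<open>Dyadic martingales and their Walsh coefficients\<close>

lemma space_dyadic_filtration [simp]: "space (dyadic_filtration n) = {0..<1}"
  by (simp add: dyadic_filtration_def space_measure_of_conv)

lemma dyadic_interval_subset: "k < 2 ^ n \<Longrightarrow> dyadic_interval n k \<subseteq> {0..<1}"
proof -
  assume "k < 2 ^ n"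
  then have "real (Suc k) \<le> real (2 ^ n)" by (subst of_nat_le_iff) simp
  then have "(real k + 1) / 2 ^ n \<le> 1" by simp
  then show ?thesis by (auto simp: dyadic_interval_def intro: order_trans[rotated])
qed

lemma mem_dyadic_interval: "x \<in> dyadic_interval n k \<longleftrightarrow> \<lfloor>2 ^ n * x\<rfloor> = int k"
  by (auto simp: dyadic_interval_def floor_eq_iff field_simps)

lemma dyadic_interval_eq_cell: "x \<in> dyadic_interval n k \<Longrightarrow> dyadic_interval n k = cell n x"
  unfolding cell_def by (auto simp: mem_dyadic_interval)

lemma ex_dyadic_interval:
  assumes "x \<in> {0..<1}"
  shows "\<exists>k<2 ^ n. x \<in> dyadic_interval n k"
proof (intro exI conjI)
  let ?k = "nat \<lfloor>2 ^ n * x\<rfloor>"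
  show "x \<in> dyadic_interval n ?k" using assms by (simp add: mem_dyadic_interval)
  have "2 ^ n * x < of_int (2 ^ n)" using assms by simp
  then have "\<lfloor>2 ^ n * x\<rfloor> < 2 ^ n" by (simp only: floor_less_iff)
  then show "?k < 2 ^ n" using assms by (simp add: nat_less_iff)
qed

lemma sets_dyadic_filtration:
  "sets (dyadic_filtration n) = sigma_sets {0..<1} {dyadic_interval n k | k. k < 2 ^ n}"
  unfolding dyadic_filtration_def using dyadic_interval_subset by (intro sets_measure_of) blast

lemma subalgebra_dyadic: "subalgebra Omega (dyadic_filtration n)"
  unfolding subalgebra_def
proof
  show "sets (dyadic_filtration n) \<subseteq> sets Omega"
    unfolding sets_dyadic_filtration space_Omega[symmetric]
  proof (rule sets.sigma_sets_subset)
    show "{dyadic_interval n k |k. k < 2 ^ n} \<subseteq> sets Omega"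
      using dyadic_interval_subset by (auto simp: Omega_def sets_restrict_space_iff) (simp add: dyadic_interval_def)
  qed
qed simp

lemma sigma_finite_dyadic: "sigma_finite_subalgebra Omega (dyadic_filtration n)"
  by (intro finite_measure_subalgebra_is_sigma_finite finite_measure_subalgebra.intro
      finite_measure_subalgebra_axioms.intro subalgebra_dyadic Omega.finite_measure_axioms)

text \<open>
  Measurability with respect to the dyadic filtration at level \<open>n\<close> means to be constant on the cells
  of level \<open>n\<close>; the two directions follow.
\<close>

lemma dyadic_measurable_cong:
  fixes h :: "real \<Rightarrow> real"
  assumes h: "h \<in> borel_measurable (dyadic_filtration n)" and x: "x \<in> {0..<1}" and t: "t \<in> cell n x"
  shows "h t = h x"
proof -
  have t': "t \<in> {0..<1}" by (rule subsetD[OF cell_subset_unit[OF x] t])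
  have inv: "t \<in> A \<longleftrightarrow> x \<in> A" if "A \<in> sigma_sets {0..<1} {dyadic_interval n k | k. k < 2 ^ n}" for A
    using that
  proof induction
    case (Basic A)
    then show ?case using t by (auto simp: mem_dyadic_interval cell_def)
  next
    case (Compl A)
    then show ?case using x t' by blast
  qed auto
  have "h -` {h x} \<inter> space (dyadic_filtration n) \<in> sets (dyadic_filtration n)"
    by (rule measurable_sets[OF h]) simp
  then show ?thesis using inv[of "h -` {h x} \<inter> {0..<1}"] x by (simp add: sets_dyadic_filtration)
qed

lemma dyadic_measurableI:
  fixes h :: "real \<Rightarrow> real"
  assumes h: "\<And>x t. x \<in> {0..<1} \<Longrightarrow> t \<in> cell n x \<Longrightarrow> h t = h x"
  shows "h \<in> borel_measurable (dyadic_filtration n)"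
proof (rule measurableI)
  fix A :: "real set"
  let ?K = "{k. k < 2 ^ n \<and> dyadic_interval n k \<subseteq> h -` A}"
  have "h -` A \<inter> space (dyadic_filtration n) = (\<Union>k\<in>?K. dyadic_interval n k)"
  proof (intro equalityI subsetI)
    fix x assume "x \<in> h -` A \<inter> space (dyadic_filtration n)"
    then have x: "h x \<in> A" "x \<in> {0..<1}" by auto
    then obtain k where k: "k < 2 ^ n" "x \<in> dyadic_interval n k" using ex_dyadic_interval by blast
    have "dyadic_interval n k \<subseteq> h -` A"
    proof
      fix t assume "t \<in> dyadic_interval n k"
      then have "h t = h x" using h[OF x(2)] dyadic_interval_eq_cell[OF k(2)] by blast
      then show "t \<in> h -` A" using x(1) by simp
    qed
    then show "x \<in> (\<Union>k\<in>?K. dyadic_interval n k)" using k by blast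
  next
    fix x assume "x \<in> (\<Union>k\<in>?K. dyadic_interval n k)"
    then show "x \<in> h -` A \<inter> space (dyadic_filtration n)" using dyadic_interval_subset by fastforce
  qed
  also have "\<dots> \<in> sets (dyadic_filtration n)"
    by (rule sets.finite_UN) (auto simp: sets_dyadic_filtration)
  finally show "h -` A \<inter> space (dyadic_filtration n) \<in> sets (dyadic_filtration n)" .
qed simp

lemma avg_cell_const:
  assumes x: "x \<in> {0..<1}" and G: "\<And>t. t \<in> cell m x \<Longrightarrow> G t = G x"
  shows "avg m G x = G x"
proof -
  have "(\<lambda>t. indicator (cell m x) t * G t) = (\<lambda>t. indicator (cell m x) t * G x)"
  proof
    fix t
    show "indicator (cell m x) t * G t = indicator (cell m x) t * G x"
    proof (cases "t \<in> cell m x")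
      case True
      then show ?thesis by (simp only: G[OF True])
    qed simp
  qed
  then have "avg m G x = avg m (\<lambda>_. G x) x" by (simp add: avg_def)
  then show ?thesis using avg_const[OF x] by simp
qed

lemma avg_eq_0_imp_integral_eq_0:
  assumes F: "integrable Omega F" and "\<And>x. x \<in> {0..<1} \<Longrightarrow> avg m F x = 0"
  shows "(\<integral>t. F t \<partial>Omega) = 0"
  using assms(2)
proof (induction m)
  case 0
  then show ?case using avg_0[of 0 F] by simp
next
  case (Suc m)
  have "avg m F x = 0" if "x \<in> {0..<1}" for x
    using avg_eq_halves[OF F, of m x] Suc.prems[OF that] Suc.prems[of "flip m x"] that by simp
  then show ?case by (rule Suc.IH)
qed

lemma integrable_walsh: "integrable Omega (walsh n)"
  by (rule Omega.integrable_const_bound[where B = 1]) (auto intro!: borel_measurable_Omega walsh_measurable)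

lemma integral_walsh:
  assumes "0 < k"
  shows "(\<integral>t. walsh k t \<partial>Omega) = 0"
proof -
  obtain m where m: "2 ^ m \<le> k" "k < 2 ^ Suc m" using ex_power_ivl1[of 2 k] assms by auto
  define l where "l = k - 2 ^ m"
  have k: "k = 2 ^ m + l" and l: "l < 2 ^ m" using m by (auto simp: l_def)
  have wk: "walsh k = (\<lambda>t. rademacher m t * walsh l t)" using walsh_add[OF l] k by auto
  have int: "integrable Omega (walsh l)" by (rule integrable_walsh)
  show ?thesis
  proof (rule avg_eq_0_imp_integral_eq_0[OF integrable_walsh, of m])
    fix x :: real assume x: "x \<in> {0..<1}"
    have "avg m (walsh l) x = walsh l x" "avg (Suc m) (walsh l) x = walsh l x"
      by (rule avg_cell_const[OF x], rule walsh_cell_cong, use l in auto)+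
    then have "rademacher m x * avg m (walsh k) x = 0"
      using avg_Suc[OF int, of m x] wk by simp
    then show "avg m (walsh k) x = 0" using rademacher_cases[of m x] by auto
  qed
qed

lemma walsh_sum_minus_const:
  assumes F: "integrable Omega F" and "0 < n"
  shows "walsh_sum (\<lambda>t. F t - c) n x = walsh_sum F n x - c"
proof -
  have int: "integrable Omega (\<lambda>t. F t * walsh k t)" for k
    using integrable_mult_bounded[OF F, of "walsh k"] by (simp add: mult.commute)
  have "(\<integral>t. (F t - c) * walsh k t \<partial>Omega) = (\<integral>t. F t * walsh k t \<partial>Omega) - (if k = 0 then c else 0)" for k
  proof -
    have "(\<integral>t. (F t - c) * walsh k t \<partial>Omega) = (\<integral>t. F t * walsh k t - c * walsh k t \<partial>Omega)"
      by (simp add: algebra_simps)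
    also have "\<dots> = (\<integral>t. F t * walsh k t \<partial>Omega) - (\<integral>t. c * walsh k t \<partial>Omega)"
      by (rule Bochner_Integration.integral_diff[OF int]) (simp add: integrable_walsh)
    also have "(\<integral>t. c * walsh k t \<partial>Omega) = (if k = 0 then c else 0)"
      using integral_walsh[of k] Omega.prob_space by (auto simp del: space_Omega)
    finally show ?thesis .
  qed
  then have "walsh_sum (\<lambda>t. F t - c) n x
      = (\<Sum>k<n. (\<integral>t. F t * walsh k t \<partial>Omega) * walsh k x - (if k = 0 then c else 0))"
    unfolding walsh_sum_def by (intro sum.cong) (auto simp: left_diff_distrib)
  also have "\<dots> = walsh_sum F n x - c"
    using assms(2) by (simp add: sum_subtractf walsh_sum_def)
  finally show ?thesis .
qed

lemma fejer_sum_minus_const: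
  assumes F: "integrable Omega F"
  shows "fejer_sum (\<lambda>t. F t - c) n x = fejer_sum F n x - n * c"
proof -
  have "fejer_sum (\<lambda>t. F t - c) n x = (\<Sum>k=1..n. walsh_sum F k x - c)"
    unfolding fejer_sum_def by (intro sum.cong refl walsh_sum_minus_const F) auto
  then show ?thesis by (simp add: sum_subtractf fejer_sum_def)
qed

lemma walsh_coeff_eq:
  assumes f: "dyadic_martingale f" and k: "k < 2 ^ L"
  shows "walsh_coeff f k = (\<integral>x. f L x * walsh k x \<partial>Omega)"
proof -
  have eq: "(\<integral>x. f K x * walsh k x \<partial>Omega) = (\<integral>x. f L x * walsh k x \<partial>Omega)" if "L \<le> K" for K
  proof -
    have w: "walsh k \<in> borel_measurable (dyadic_filtration L)"
      by (rule dyadic_measurableI) (use walsh_cell_cong[OF k] in blast)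
    have fK: "integrable Omega (f K)" and fL: "integrable Omega (f L)" using f by (auto simp: dyadic_martingale_def)
    have ce: "AE x in Omega. real_cond_exp Omega (dyadic_filtration L) (f K) x = f L x"
      using f that by (auto simp: dyadic_martingale_def)
    have "(\<integral>x. walsh k x * f K x \<partial>Omega) = (\<integral>x. walsh k x * real_cond_exp Omega (dyadic_filtration L) (f K) x \<partial>Omega)"
      by (rule sigma_finite_subalgebra.real_cond_exp_intg(2)[OF sigma_finite_dyadic, symmetric])
         (use fK w integrable_mult_bounded[OF fK walsh_measurable] in auto)
    also have "\<dots> = (\<integral>x. walsh k x * f L x \<partial>Omega)"
    proof (rule integral_cong_AE)
      show "AE x in Omega. walsh k x * real_cond_exp Omega (dyadic_filtration L) (f K) x = walsh k x * f L x"
        using ce by eventually_elim simp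
    qed (use fL borel_measurable_Omega[OF walsh_measurable] in measurable)
    finally show ?thesis by (simp add: mult.commute)
  qed
  show ?thesis
    unfolding walsh_coeff_def
  proof (rule limI, rule tendsto_eventually)
    show "\<forall>\<^sub>F K in sequentially. (\<integral>x. f K x * walsh k x \<partial>Omega) = (\<integral>x. f L x * walsh k x \<partial>Omega)"
      by (rule eventually_sequentiallyI[of L]) (rule eq)
  qed
qed

lemma fejer_mean_eq:
  assumes f: "dyadic_martingale f" and n: "n \<le> 2 ^ L"
  shows "fejer_mean f n x = fejer_sum (f L) n x / n"
proof -
  have "walsh_partial_sum f k x = walsh_sum (f L) k x" if "k \<le> n" for k
    unfolding walsh_partial_sum_def walsh_sum_def
    using that n by (intro sum.cong refl) (simp add: walsh_coeff_eq[OF f, of _ L])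
  then have "(\<Sum>k=1..n. walsh_partial_sum f k x) = fejer_sum (f L) n x"
    unfolding fejer_sum_def by (intro sum.cong refl) auto
  then show ?thesis by (simp add: fejer_mean_def)
qed

section \<open>Majorants for the martingale\<close>

text \<open>
  Inside \<open>I\<close> the martingale is an average of \<open>g\<close>, and averaging does not increase absolute values.
\<close>

lemma restriction_avg_le:
  assumes f: "dyadic_martingale f" and g: "restriction_generated_by f i I g"
    and L: "i \<le> L" "m \<le> L" and sub: "cell m y \<subseteq> I"
  shows "avg m (\<lambda>t. \<bar>f L t - c\<bar>) y \<le> avg m (\<lambda>t. \<bar>g t * indicator I t - c\<bar>) y"
proof -
  let ?g = "\<lambda>t. g t * indicator I t"
  have g_int: "integrable Omega ?g"
    using g by (simp add: restriction_generated_by_def set_integrable_def mult.commute)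
  have f_int: "integrable Omega (f L)" and f_meas: "f L \<in> borel_measurable (dyadic_filtration L)"
    using f by (auto simp: dyadic_martingale_def)
  have ce: "AE x in Omega. f L x * indicator I x = real_cond_exp Omega (dyadic_filtration L) ?g x"
    using g L(1) by (auto simp: restriction_generated_by_def)
  \<comment> \<open>Testing against the sign turns the absolute value into a linear functional.\<close>
  define s where "s t = sgn (f L t - c) * indicator (cell m y) t" for t
  have s_meas: "s \<in> borel_measurable (dyadic_filtration L)"
  proof (rule dyadic_measurableI)
    fix x t :: real assume x: "x \<in> {0..<1}" and t: "t \<in> cell L x"
    have "f L t = f L x" by (rule dyadic_measurable_cong[OF f_meas x t])
    moreover have "cell m t = cell m x" using cell_antimono[OF L(2)] t by (intro cell_eq) auto
    then have "t \<in> cell m y \<longleftrightarrow> x \<in> cell m y" using cell_sym by metis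
    ultimately show "s t = s x" by (simp add: s_def indicator_def)
  qed
  have s_Omega: "s \<in> borel_measurable Omega"
    by (rule measurable_from_subalg[OF subalgebra_dyadic s_meas])
  have s_le: "\<bar>s t\<bar> \<le> 1" for t by (auto simp: s_def indicator_def sgn_if)
  have int: "integrable Omega (\<lambda>t. s t * F t)" if "integrable Omega F" for F
    by (rule integrable_mult_bounded_Omega[OF that s_Omega s_le])
  have "(\<integral>t. s t * f L t \<partial>Omega) = (\<integral>t. s t * real_cond_exp Omega (dyadic_filtration L) ?g t \<partial>Omega)"
  proof (rule integral_cong_AE)
    show "AE t in Omega. s t * f L t = s t * real_cond_exp Omega (dyadic_filtration L) ?g t"
      using ce
    proof eventually_elim
      case (elim t)
      show ?case
      proof (cases "t \<in> cell m y")
        case True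
        then have "t \<in> I" using sub by auto
        then show ?thesis using elim by simp
      qed (simp add: s_def)
    qed
  qed (use s_Omega f_int in measurable)
  also have "\<dots> = (\<integral>t. s t * ?g t \<partial>Omega)"
    by (rule sigma_finite_subalgebra.real_cond_exp_intg(2)[OF sigma_finite_dyadic int[OF g_int] s_meas])
       (use g_int in auto)
  finally have eq: "(\<integral>t. s t * f L t \<partial>Omega) = (\<integral>t. s t * ?g t \<partial>Omega)" .
  have "(\<integral>t. indicator (cell m y) t * \<bar>f L t - c\<bar> \<partial>Omega) = (\<integral>t. s t * f L t - s t * c \<partial>Omega)"
    by (intro Bochner_Integration.integral_cong refl) (auto simp: s_def indicator_def sgn_if abs_if)
  also have "\<dots> = (\<integral>t. s t * f L t \<partial>Omega) - (\<integral>t. s t * c \<partial>Omega)"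
    by (intro Bochner_Integration.integral_diff int f_int) simp
  also have "\<dots> = (\<integral>t. s t * ?g t \<partial>Omega) - (\<integral>t. s t * c \<partial>Omega)"
    by (simp only: eq)
  also have "\<dots> = (\<integral>t. s t * ?g t - s t * c \<partial>Omega)"
    by (intro Bochner_Integration.integral_diff[symmetric] int g_int) simp
  also have "\<dots> \<le> (\<integral>t. indicator (cell m y) t * \<bar>?g t - c\<bar> \<partial>Omega)"
  proof (rule integral_mono)
    show "integrable Omega (\<lambda>t. s t * ?g t - s t * c)"
      by (intro Bochner_Integration.integrable_diff int g_int) simp
    show "integrable Omega (\<lambda>t. indicator (cell m y) t * \<bar>?g t - c\<bar>)"
      by (rule integrable_indicator_cell) (use g_int in auto)
    show "s t * ?g t - s t * c \<le> indicator (cell m y) t * \<bar>?g t - c\<bar>" for t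
    proof -
      have "s t * ?g t - s t * c = s t * (?g t - c)" by (simp add: right_diff_distrib)
      also have "\<dots> \<le> \<bar>s t\<bar> * \<bar>?g t - c\<bar>" by (simp add: abs_mult[symmetric])
      also have "\<dots> \<le> indicator (cell m y) t * \<bar>?g t - c\<bar>"
        by (rule mult_right_mono) (auto simp: s_def indicator_def sgn_if)
      finally show ?thesis .
    qed
  qed
  finally show ?thesis
    unfolding avg_def by (rule mult_left_mono) simp
qed

text \<open>
  The growth estimate off \<open>I\<close>. A function \<open>h\<close> that is constant on cells of level \<open>L\<close> satisfies
  \<open>\<bar>h\<bar> powr q \<le> 2 ^ L R\<close> on \<open>cell m y\<close>, so that \<open>\<bar>h\<bar>\<close> is
  a product of \<open>\<bar>h\<bar> powr q\<close>, which is at most \<open>v\<close>, and a bounded factor. The resulting rate \<open>2 powr (1 / q - 1)\<close> is below 2 exactly when \<open>q > 1 / 2\<close>.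
\<close>

lemma avg_abs_le_powr:
  fixes h v :: "real \<Rightarrow> real"
  assumes q: "0 < q" "q < 1"
    and h: "integrable Omega h" "h \<in> borel_measurable (dyadic_filtration L)"
    and v: "integrable Omega v" "\<And>x. 0 \<le> v x" "AE x in Omega. \<bar>h x\<bar> powr q \<le> v x"
    and m: "m \<le> L" and y: "y \<in> {0..<1}" and R: "avg m v y \<le> R"
  shows "avg m (\<lambda>t. \<bar>h t\<bar>) y \<le> R powr (1 / q) * (2 powr (1 / q - 1)) ^ L"
proof -
  let ?a = "1 / q - 1"
  have R0: "0 \<le> R" using R avg_nonneg[of v m y, OF v(2)] by linarith
  have hq: "integrable Omega (\<lambda>x. \<bar>h x\<bar> powr q)"
  proof (rule Bochner_Integration.integrable_bound[OF v(1)])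
    show "(\<lambda>x. \<bar>h x\<bar> powr q) \<in> borel_measurable Omega" using h(1) by measurable
    show "AE x in Omega. norm (\<bar>h x\<bar> powr q) \<le> norm (v x)" using v(3) by eventually_elim (simp add: v(2))
  qed
  have pw: "\<bar>h t\<bar> powr q \<le> 2 ^ L * R" if t: "t \<in> cell m y" for t
  proof -
    have t': "t \<in> {0..<1}" by (rule subsetD[OF cell_subset_unit[OF y] t])
    have sub: "cell L t \<subseteq> cell m y"
      using cell_antimono[OF m, of t] cell_eq[OF t] by simp
    have "\<bar>h t\<bar> powr q = avg L (\<lambda>x. \<bar>h x\<bar> powr q) t"
      by (rule avg_cell_const[OF t', symmetric]) (simp only: dyadic_measurable_cong[OF h(2) t'])
    also have "\<dots> \<le> avg L v t"
      by (rule avg_mono[OF hq v(1)]) (use v(3) in eventually_elim, simp)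
    also have "\<dots> \<le> 2 ^ L * (\<integral>x. indicator (cell m y) x * v x \<partial>Omega)"
      unfolding avg_def
      by (intro mult_left_mono integral_mono integrable_indicator_cell v mult_right_mono)
         (use sub in \<open>auto simp: indicator_def\<close>)
    also have "\<dots> \<le> 2 ^ L * avg m v y"
    proof -
      let ?X = "\<integral>x. indicator (cell m y) x * v x \<partial>Omega"
      have "0 \<le> ?X" using v(2) by (intro Bochner_Integration.integral_nonneg) simp
      then have "1 * ?X \<le> 2 ^ m * ?X" by (intro mult_right_mono) simp_all
      then show ?thesis unfolding avg_def by (intro mult_left_mono) simp_all
    qed
    also have "\<dots> \<le> 2 ^ L * R" using R by simp
    finally show ?thesis .
  qed
  have pt: "AE t in Omega. t \<in> cell m y \<longrightarrow> \<bar>h t\<bar> \<le> v t * (2 ^ L * R) powr ?a"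
    using v(3)
  proof (eventually_elim, intro impI)
    fix t assume le: "\<bar>h t\<bar> powr q \<le> v t" and t: "t \<in> cell m y"
    have "\<bar>h t\<bar> = \<bar>h t\<bar> powr (q + q * ?a)" using q by (simp add: algebra_simps)
    also have "\<dots> = \<bar>h t\<bar> powr q * (\<bar>h t\<bar> powr q) powr ?a" by (simp only: powr_add powr_powr)
    also have "\<dots> \<le> v t * (2 ^ L * R) powr ?a"
      using q by (intro mult_mono le powr_mono2 pw t v) auto
    finally show "\<bar>h t\<bar> \<le> v t * (2 ^ L * R) powr ?a" .
  qed
  have "avg m (\<lambda>t. \<bar>h t\<bar>) y \<le> avg m (\<lambda>t. v t * (2 ^ L * R) powr ?a) y"
    by (rule avg_mono[OF _ _ pt]) (use h(1) v(1) in auto)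
  also have "\<dots> = avg m v y * (2 ^ L * R) powr ?a"
    unfolding avg_def by (simp add: mult.assoc[symmetric])
  also have "\<dots> \<le> R * (2 ^ L * R) powr ?a"
    by (intro mult_right_mono R) simp
  also have "\<dots> = R powr (1 / q) * (2 powr ?a) ^ L"
  proof -
    have "(2 ^ L * R) powr ?a = (2 ^ L) powr ?a * R powr ?a"
      by (rule powr_mult)
    moreover have "((2::real) ^ L) powr ?a = (2 powr ?a) ^ L"
      by (simp add: powr_realpow[symmetric] powr_powr mult.commute)
    moreover have "R * R powr ?a = R powr (1 / q)"
    proof -
      have "R * R powr ?a = R powr 1 * R powr ?a" using R0 by simp
      also have "\<dots> = R powr (1 / q)" by (subst powr_add[symmetric]) simp
      finally show ?thesis .
    qed
    ultimately show ?thesis by (simp add: ac_simps)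
  qed
  finally show ?thesis .
qed

text \<open>
  A variable exponent above some constant \<open>q\<close> gives more integrability than the constant \<open>q\<close>, as the
  measure is finite. The bound \<open>q < 1\<close> is no loss and fixes the sign of \<open>1 / q - 1\<close>.
\<close>

lemma hardy_space_majorant:
  assumes p: "p \<in> borel_measurable Omega" and p_half: "1 / 2 < p_minus p {0..<1}"
    and f: "f \<in> hardy_space p"
  shows "\<exists>q v. 1 / 2 < q \<and> q < 1 \<and> integrable Omega v \<and> (\<forall>x. 0 \<le> v x)
    \<and> (\<forall>n. AE x in Omega. \<bar>f n x\<bar> powr q \<le> v x)"
proof -
  have f_int: "integrable Omega (f n)" for n
    using f by (auto simp: hardy_space_def dyadic_martingale_def)
  have [measurable]: "f n \<in> borel_measurable Omega" for n using f_int by (rule borel_measurable_integrable)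
  note p[measurable]
  obtain c where c: "1 / 2 < c" "AE x in restrict_space Omega {0..<1}. c \<le> ereal (p x)"
    using p_half unfolding p_minus_def less_Sup_iff by auto
  have "max (ereal (1/2)) (ereal (1/2)) < min c 1" using c(1) by (simp add: one_ereal_def divide_ereal_def)
  then obtain q where q: "ereal (1/2) < ereal q" "ereal q < min c 1"
    using ereal_dense2[of "ereal (1/2)" "min c 1"] by auto
  have q1: "1/2 < q" "q < 1" using q by (auto simp: one_ereal_def)
  have "AE x in Omega. c \<le> ereal (p x)"
    using c(2) by (subst (asm) AE_restrict_space_iff) (auto simp: Omega_def sets_restrict_space_iff)
  then have qp: "AE x in Omega. q \<le> p x"
  proof eventually_elim
    case (elim x)
    have "ereal q < c" using q(2) by simp
    then have "ereal q < ereal (p x)" using elim by (rule less_le_trans)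
    then show ?case by simp
  qed
  have "var_norm p (maximal_function f) < \<infinity>" using f by (simp add: hardy_space_def)
  then obtain l where l: "0 < l"
    and le1: "(\<integral>\<^sup>+x. ennreal_powr (maximal_function f x / ennreal l) (p x) \<partial>Omega) \<le> 1"
    unfolding var_norm_def by (auto simp: Inf_less_iff)
  have [measurable]: "maximal_function f \<in> borel_measurable Omega"
  proof -
    have "(\<lambda>x. SUP n. ennreal \<bar>f n x\<bar>) \<in> borel_measurable Omega" by measurable
    then show ?thesis by (simp add: maximal_function_def[abs_def])
  qed
  define u where "u x = maximal_function f x / ennreal l" for x
  define b where "b x = enn2real (u x)" for x
  have [measurable]: "u \<in> borel_measurable Omega" unfolding u_def[abs_def] by measurable
  have [measurable]: "b \<in> borel_measurable Omega" unfolding b_def[abs_def] by measurable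
  define w where "w x = ennreal_powr (u x) (p x)" for x
  have w_meas [measurable]: "w \<in> borel_measurable Omega"
    unfolding w_def[abs_def] ennreal_powr_def b_def[symmetric] by measurable
  have w_le: "(\<integral>\<^sup>+x. w x \<partial>Omega) \<le> 1" using le1 by (simp add: w_def u_def)
  have "AE x in Omega. w x \<noteq> \<infinity>"
    by (rule nn_integral_PInf_AE[OF w_meas]) (use w_le in \<open>auto simp: top_unique\<close>)
  then have u_fin: "AE x in Omega. u x \<noteq> \<infinity>"
    by eventually_elim (auto simp: w_def ennreal_powr_def)
  define v where "v x = l powr q * b x powr q" for x
  have v_meas [measurable]: "v \<in> borel_measurable Omega" unfolding v_def[abs_def] by measurable
  have v_pos: "0 \<le> v x" for x by (simp add: v_def)
  have v_le: "AE x in Omega. ennreal (v x) \<le> ennreal (l powr q) * (1 + w x)"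
    using qp u_fin
  proof eventually_elim
    case (elim x)
    have b0: "0 \<le> b x" by (simp add: b_def)
    have "b x powr q \<le> 1 + b x powr p x"
    proof (cases "b x \<le> 1")
      case True
      then have "b x powr q \<le> 1" using b0 q1 by (intro powr_le1) auto
      then show ?thesis by (simp add: add_increasing2)
    next
      case False
      then have "b x powr q \<le> b x powr p x" using elim by (intro powr_mono) auto
      then show ?thesis by simp
    qed
    then have "v x \<le> l powr q * (1 + b x powr p x)" unfolding v_def by (intro mult_left_mono) auto
    then have "ennreal (v x) \<le> ennreal (l powr q * (1 + b x powr p x))" by (rule ennreal_leI)
    also have "\<dots> = ennreal (l powr q) * (1 + w x)"
      using elim by (simp add: ennreal_mult w_def ennreal_powr_def b_def)
    finally show ?case .
  qed
  have "integrable Omega v"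
  proof (rule integrableI_nonneg)
    have "(\<integral>\<^sup>+x. ennreal (v x) \<partial>Omega) \<le> (\<integral>\<^sup>+x. ennreal (l powr q) * (1 + w x) \<partial>Omega)"
      by (rule nn_integral_mono_AE[OF v_le])
    also have "\<dots> = ennreal (l powr q) * (1 + (\<integral>\<^sup>+x. w x \<partial>Omega))"
      using Omega.emeasure_space_1 by (simp add: nn_integral_cmult nn_integral_add)
    also have "\<dots> \<le> ennreal (l powr q) * (1 + 1)"
      by (intro mult_left_mono add_left_mono w_le) auto
    also have "\<dots> < \<infinity>" by (simp add: ennreal_mult_less_top)
    finally show "(\<integral>\<^sup>+x. ennreal (v x) \<partial>Omega) < \<infinity>" .
  qed (auto simp: v_pos)
  moreover have "AE x in Omega. \<bar>f n x\<bar> powr q \<le> v x" for n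
    using u_fin
  proof eventually_elim
    case (elim x)
    have "ennreal (\<bar>f n x\<bar> / l) = ennreal \<bar>f n x\<bar> / ennreal l"
      using l by (simp add: divide_ennreal)
    also have "\<dots> \<le> u x"
      unfolding u_def maximal_function_def by (intro divide_right_mono_ennreal SUP_upper) simp
    also have "u x = ennreal (b x)" using elim by (simp add: b_def less_top)
    finally have "\<bar>f n x\<bar> / l \<le> b x" by (subst (asm) ennreal_le_iff) (auto simp: b_def)
    then have "\<bar>f n x\<bar> \<le> l * b x" using l by (simp add: field_simps)
    then have "\<bar>f n x\<bar> powr q \<le> (l * b x) powr q" using q1 by (intro powr_mono2) auto
    also have "\<dots> = v x" using l by (simp add: v_def powr_mult b_def)
    finally show ?case .
  qed
  ultimately show ?thesis using q1 v_pos by blast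
qed

section \<open>Pointwise convergence\<close>

lemma weighted_mean_tendsto_0:
  fixes a :: "nat \<Rightarrow> real"
  assumes pos: "\<And>m. 0 \<le> a m" and a: "(\<lambda>m. a m / 2 ^ m) \<longlonglongrightarrow> 0"
  shows "(\<lambda>N. (\<Sum>m\<le>N. a m) / 2 ^ N) \<longlonglongrightarrow> 0"
proof (rule LIMSEQ_I)
  fix e :: real assume e: "0 < e"
  have "\<forall>\<^sub>F m in sequentially. a m / 2 ^ m < e / 4"
    by (rule order_tendstoD(2)[OF a]) (use e in simp)
  then obtain M where M: "\<And>m. M \<le> m \<Longrightarrow> a m / 2 ^ m < e / 4" by (auto simp: eventually_sequentially)
  let ?C = "\<Sum>m<M. a m"
  have bound: "(\<Sum>m\<le>N. a m) \<le> ?C + 2 * 2 ^ N * (e / 4)" for N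
  proof -
    have "(\<Sum>m\<le>N. a m) \<le> (\<Sum>m\<le>N. (if m < M then a m else 0) + 2 ^ m * (e / 4))"
    proof (rule sum_mono)
      fix m
      show "a m \<le> (if m < M then a m else 0) + 2 ^ m * (e / 4)"
        using M[of m] e by (cases "m < M") (auto simp: field_simps)
    qed
    also have "\<dots> = (\<Sum>m\<in>{..N} \<inter> {..<M}. a m) + (\<Sum>m\<le>N. 2 ^ m) * (e / 4)"
      by (simp add: sum.distrib sum_distrib_right sum.If_cases lessThan_def)
    also have "\<dots> \<le> ?C + 2 * 2 ^ N * (e / 4)"
      unfolding sum_power2_atMost using e pos by (intro add_mono mult_right_mono sum_mono2) auto
    finally show ?thesis .
  qed
  have "(\<lambda>N. ?C * (1 / 2) ^ N) \<longlonglongrightarrow> ?C * 0"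
    by (intro tendsto_mult_left LIMSEQ_power_zero) simp
  then have "\<forall>\<^sub>F N in sequentially. ?C * (1 / 2) ^ N < e / 2"
    by (rule order_tendstoD) (use e in simp)
  then obtain N0 where N0: "\<And>N. N0 \<le> N \<Longrightarrow> ?C * (1 / 2) ^ N < e / 2" by (auto simp: eventually_sequentially)
  show "\<exists>N0. \<forall>N\<ge>N0. norm ((\<Sum>m\<le>N. a m) / 2 ^ N - 0) < e"
  proof (intro exI allI impI)
    fix N assume N: "N0 \<le> N"
    have "(\<Sum>m\<le>N. a m) / 2 ^ N \<le> (?C + 2 * 2 ^ N * (e / 4)) / 2 ^ N"
      by (intro divide_right_mono bound) simp
    also have "\<dots> = ?C * (1 / 2) ^ N + e / 2" by (simp add: field_simps power_one_over)
    also have "\<dots> < e" using N0[OF N] by linarith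
    finally have "(\<Sum>m\<le>N. a m) / 2 ^ N < e" .
    moreover have "0 \<le> (\<Sum>m\<le>N. a m) / 2 ^ N" by (intro divide_nonneg_nonneg sum_nonneg pos) auto
    ultimately show "norm ((\<Sum>m\<le>N. a m) / 2 ^ N - 0) < e" by simp
  qed
qed


text \<open>
  Convergence at a single point \<open>x\<close> of \<open>I\<close> that is a Lebesgue point of \<open>g\<close> and around whose flipped
  points the averages of \<open>v\<close> are bounded. Flips with \<open>j \<ge> i\<close> stay in \<open>I\<close> and see \<open>g\<close> only; the
  finitely many flips with \<open>j < i\<close> leave \<open>I\<close>, and there the growth rate \<open>\<beta> < 2\<close> loses against the
  factor \<open>1 / n\<close>.
\<close>

lemma fejer_mean_tendsto:
  assumes f: "dyadic_martingale f" and g: "restriction_generated_by f i I g"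
    and I: "I = dyadic_interval i j0" "j0 < 2 ^ i" and x: "x \<in> I"
    and q: "1 / 2 < q" "q < 1"
    and v: "integrable Omega v" "\<And>t. 0 \<le> v t" "\<And>n. AE t in Omega. \<bar>f n t\<bar> powr q \<le> v t"
    and Leb: "(\<lambda>m. flip_sum m (\<lambda>t. \<bar>g t * indicator I t - g x\<bar>) x / 2 ^ m) \<longlonglongrightarrow> 0"
    and R: "\<And>j m. avg m v (flip j x) \<le> R j"
  shows "(\<lambda>n. fejer_mean f n x) \<longlonglongrightarrow> g x"
proof -
  define c where "c = g x"
  define \<beta> where "\<beta> = 2 powr (1 / q - 1)"
  define D where "D = (\<Sum>j<i. R j powr (1 / q))"
  define K where "K = real i * (2 ^ i * (D + \<bar>c\<bar>))"
  let ?G = "\<lambda>t. \<bar>g t * indicator I t - c\<bar>"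
  have xu: "x \<in> {0..<1}" using x I dyadic_interval_subset by blast
  have I_cell: "I = cell i x" using x I dyadic_interval_eq_cell by simp
  have G_int: "integrable Omega ?G"
    using g by (simp add: restriction_generated_by_def set_integrable_def mult.commute)
  have f_int: "integrable Omega (f L)" and f_meas: "f L \<in> borel_measurable (dyadic_filtration L)" for L
    using f by (auto simp: dyadic_martingale_def)
  have F_int: "integrable Omega (\<lambda>t. \<bar>f L t - c\<bar>)" for L using f_int[of L] by auto
  have q0: "0 < q" using q by simp
  have "1 / q < 2" "1 < 1 / q" using q by (simp_all add: field_simps)
  then have \<beta>: "1 \<le> \<beta>" "\<beta> < 2"
    unfolding \<beta>_def using powr_less_mono[of "1 / q - 1" 1 2] by (auto intro: ge_one_powr_ge_zero)
  have D: "R j powr (1 / q) \<le> D" if "j < i" for j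
    unfolding D_def by (rule member_le_sum) (use that in auto)
  have D0: "0 \<le> D" unfolding D_def by (intro sum_nonneg) simp
  have step: "flip_sum m (\<lambda>t. \<bar>f L t - c\<bar>) x \<le> flip_sum m ?G x + K * \<beta> ^ L" if L: "i \<le> L" "m \<le> L" for m L
  proof -
    let ?B = "2 ^ i * ((D + \<bar>c\<bar>) * \<beta> ^ L)"
    have \<beta>L: "1 \<le> \<beta> ^ L" using \<beta>(1) by (rule one_le_power)
    have B0: "0 \<le> ?B" using D0 \<beta>L by simp
    have "flip_sum m (\<lambda>t. \<bar>f L t - c\<bar>) x
        \<le> (\<Sum>j\<le>m. 2 ^ j * avg m ?G (flip j x) + (if j < i then ?B else 0))"
      unfolding flip_sum_def
    proof (rule sum_mono)
      fix j assume j: "j \<in> {..m}"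
      show "2 ^ j * avg m (\<lambda>t. \<bar>f L t - c\<bar>) (flip j x)
          \<le> 2 ^ j * avg m ?G (flip j x) + (if j < i then ?B else 0)"
      proof (cases "j < i")
        case True
        have "avg m (\<lambda>t. \<bar>f L t - c\<bar>) (flip j x) \<le> avg m (\<lambda>t. \<bar>f L t\<bar> + \<bar>c\<bar>) (flip j x)"
          by (rule avg_mono[OF F_int]) (use f_int[of L] in auto)
        also have "\<dots> = avg m (\<lambda>t. \<bar>f L t\<bar>) (flip j x) + \<bar>c\<bar>"
          using f_int[of L] avg_const[OF flip_mem_unit[OF xu], of m "\<bar>c\<bar>" j] by (subst avg_add) auto
        also have "\<dots> \<le> R j powr (1 / q) * \<beta> ^ L + \<bar>c\<bar>"
          unfolding \<beta>_def
          by (intro add_right_mono avg_abs_le_powr[OF q0 q(2) f_int f_meas v L(2) flip_mem_unit[OF xu] R])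
        also have "\<dots> \<le> D * \<beta> ^ L + \<bar>c\<bar> * \<beta> ^ L"
          using D[OF True] \<beta>L mult_left_mono[OF \<beta>L, of "\<bar>c\<bar>"] by (intro add_mono mult_right_mono) auto
        finally have "avg m (\<lambda>t. \<bar>f L t - c\<bar>) (flip j x) \<le> (D + \<bar>c\<bar>) * \<beta> ^ L"
          by (simp add: distrib_right)
        then have "2 ^ j * avg m (\<lambda>t. \<bar>f L t - c\<bar>) (flip j x) \<le> ?B"
          using True by (intro mult_mono power_increasing) (auto intro: avg_nonneg)
        moreover have "0 \<le> 2 ^ j * avg m ?G (flip j x)"
          by (intro mult_nonneg_nonneg avg_nonneg) auto
        ultimately show ?thesis using True by simp
      next
        case False
        have "cell m (flip j x) \<subseteq> cell i (flip j x)" using False j by (intro cell_antimono) auto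
        also have "\<dots> = I" unfolding I_cell using False by (intro cell_eq flip_mem_cell) simp
        finally show ?thesis
          using False restriction_avg_le[OF f g L, of "flip j x" c] by simp
      qed
    qed
    also have "\<dots> = flip_sum m ?G x + (\<Sum>j\<in>{..m} \<inter> {..<i}. ?B)"
      by (simp add: sum.distrib sum.If_cases lessThan_def flip_sum_def)
    also have "(\<Sum>j\<in>{..m} \<inter> {..<i}. ?B) \<le> (\<Sum>j\<in>{..<i}. ?B)"
      using B0 by (intro sum_mono2) auto
    also have "\<dots> = K * \<beta> ^ L" by (simp add: K_def)
    finally show ?thesis by simp
  qed
  define b where "b N = 2 * ((\<Sum>m\<le>N. flip_sum m ?G x) / 2 ^ N) + 4 * K * (real (Suc N) * (\<beta> / 2) ^ Suc N)" for N
  have b_lim: "b \<longlonglongrightarrow> 0"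
  proof -
    have "(\<lambda>N. (\<Sum>m\<le>N. flip_sum m ?G x) / 2 ^ N) \<longlonglongrightarrow> 0"
    proof (rule weighted_mean_tendsto_0)
      show "0 \<le> flip_sum m ?G x" for m
        unfolding flip_sum_def by (intro sum_nonneg mult_nonneg_nonneg avg_nonneg) auto
    qed (use Leb in \<open>simp add: c_def\<close>)
    moreover have "(\<lambda>N. real (Suc N) * (\<beta> / 2) ^ Suc N) \<longlonglongrightarrow> 0"
      by (rule LIMSEQ_Suc) (rule powser_times_n_limit_0, use \<beta> in simp)
    ultimately have "b \<longlonglongrightarrow> 2 * 0 + 4 * K * 0"
      unfolding b_def[abs_def] by (intro tendsto_intros)
    then show ?thesis by simp
  qed
  have bound: "\<bar>fejer_mean f n x - c\<bar> \<le> b N" if n: "2 ^ N \<le> n" "n < 2 ^ Suc N" and N: "i \<le> N" for n N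
  proof -
    \<comment> \<open>The Walsh coefficients of index below \<open>2 ^ (N + 1)\<close> are those of \<open>f (N + 1)\<close>.\<close>
    let ?L = "Suc N"
    have n0: "0 < n" using n(1) less_le_trans[of 0 "2 ^ N" n] by simp
    have nr: "(2::real) ^ N \<le> real n" using of_nat_mono[OF n(1), where 'a = real] by simp
    have "fejer_mean f n x - c = fejer_sum (\<lambda>t. f ?L t - c) n x / n"
      using fejer_mean_eq[OF f less_imp_le[OF n(2)]] n0
      by (simp add: fejer_sum_minus_const[OF f_int] field_simps)
    then have "\<bar>fejer_mean f n x - c\<bar> = \<bar>fejer_sum (\<lambda>t. f ?L t - c) n x\<bar> / n" by simp
    also have "\<dots> \<le> \<bar>fejer_sum (\<lambda>t. f ?L t - c) n x\<bar> / 2 ^ N"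
      using nr by (intro divide_left_mono) (auto intro!: mult_pos_pos simp: n0)
    also have "\<dots> \<le> 2 * (\<Sum>m<?L. flip_sum m (\<lambda>t. \<bar>f ?L t - c\<bar>) x) / 2 ^ N"
      by (intro divide_right_mono fejer_sum_le xu n(2)) (use f_int[of ?L] in auto)
    also have "\<dots> \<le> 2 * (\<Sum>m<?L. flip_sum m ?G x + K * \<beta> ^ ?L) / 2 ^ N"
      by (intro divide_right_mono mult_left_mono sum_mono step) (use N in auto)
    also have "\<dots> = b N"
      by (simp add: b_def sum.distrib lessThan_Suc_atMost power_divide add_divide_distrib)
    finally show ?thesis .
  qed
  have "(\<lambda>n. fejer_mean f n x) \<longlonglongrightarrow> c"
  proof (rule LIMSEQ_I)
    fix e :: real assume "0 < e"
    then have "\<forall>\<^sub>F N in sequentially. b N < e" by (rule order_tendstoD(2)[OF b_lim])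
    then obtain N0 where N0: "\<And>N. N0 \<le> N \<Longrightarrow> b N < e" by (auto simp: eventually_sequentially)
    show "\<exists>n0. \<forall>n\<ge>n0. norm (fejer_mean f n x - c) < e"
    proof (intro exI allI impI)
      fix n :: nat assume n: "2 ^ max i N0 \<le> n"
      then have "0 < n" using less_le_trans[of 0 "2 ^ max i N0" n] by simp
      then obtain N where N: "2 ^ N \<le> n" "n < 2 ^ Suc N" using ex_power_ivl1[of 2 n] by auto
      have "2 ^ max i N0 < (2::nat) ^ Suc N" using n N(2) by (rule le_less_trans)
      then have "max i N0 < Suc N" by (rule power_less_imp_less_exp[of 2, rotated]) simp
      then show "norm (fejer_mean f n x - c) < e"
        using bound[OF N] N0[of N] by simp
    qed
  qed
  then show ?thesis by (simp add: c_def)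
qed

theorem corollary5p22:
  fixes p :: "real \<Rightarrow> real" and K :: real
    and f :: "nat \<Rightarrow> real \<Rightarrow> real" and g :: "real \<Rightarrow> real"
    and i j :: nat and I :: "real set"
  assumes p_meas: "p \<in> borel_measurable Omega"
    and p_pos: "\<And>x. x \<in> {0..<1} \<Longrightarrow> 0 < p x"
    and p_bounds: "0 < p_minus p {0..<1}" "p_minus p {0..<1} \<le> p_plus p {0..<1}"
      "p_plus p {0..<1} < \<infinity>"
    and K: "K \<ge> 1"
    and log_hoelder: "\<And>n k. k < 2 ^ n \<Longrightarrow>
      measure Omega (dyadic_interval n k) powr
        (real_of_ereal (p_minus p (dyadic_interval n k))
          - real_of_ereal (p_plus p (dyadic_interval n k))) \<le> K"
    and p_gap: "1 / p_minus p {0..<1} - 1 / p_plus p {0..<1} < 1"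
    and p_half: "1 / 2 < p_minus p {0..<1}" "p_minus p {0..<1} < \<infinity>"
    and f: "f \<in> hardy_space p"
    and j: "j < 2 ^ i"
    and I: "I = dyadic_interval i j"
    and g: "restriction_generated_by f i I g"
  shows "AE x in Omega. x \<in> I \<longrightarrow> (\<lambda>n. fejer_mean f n x) \<longlonglongrightarrow> g x"
proof -
  have mart: "dyadic_martingale f" using f by (simp add: hardy_space_def)
  have g_int: "integrable Omega (\<lambda>t. g t * indicator I t)"
    using g by (simp add: restriction_generated_by_def set_integrable_def mult.commute)
  obtain q v where q: "1 / 2 < q" "q < 1" and v: "integrable Omega v" "\<And>x. 0 \<le> v x"
    "\<And>n. AE x in Omega. \<bar>f n x\<bar> powr q \<le> v x"
    using hardy_space_majorant[OF p_meas p_half(1) f] by blast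
  have "AE x in Omega. \<forall>k. \<exists>R. \<forall>m. avg m v (flip k x) \<le> R"
    unfolding AE_all_countable using AE_flip[OF AE_avg_bounded[OF v(1,2)]] by blast
  with AE_flip_sum_tendsto[OF g_int] show ?thesis
  proof (eventually_elim, intro impI)
    fix x
    assume Leb: "(\<lambda>m. flip_sum m (\<lambda>t. \<bar>g t * indicator I t - g x * indicator I x\<bar>) x / 2 ^ m) \<longlonglongrightarrow> 0"
      and bdd: "\<forall>k. \<exists>R. \<forall>m. avg m v (flip k x) \<le> R" and x: "x \<in> I"
    obtain R where "\<And>k m. avg m v (flip k x) \<le> R k" using bdd by metis
    with Leb x show "(\<lambda>n. fejer_mean f n x) \<longlonglongrightarrow> g x"
      by (intro fejer_mean_tendsto[OF mart g I j x q v]) simp_all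
  qed
qed

end
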